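(* Let $\mathbf{k}$ be a commutative ring and $n\in\mathbb{N}$. Let $i\in[f_{n+1}]$. Let $\delta_i$ be the number of all permutations $w\in S_n$ satisfying $\operatorname{Qind}w=i$. Then: (a) The $\mathbf{k}$-module $F_i/F_{i-1}$ is free and has dimension (i.e., rank) equal to $\delta_i$. (b) The number $\delta_i$ equals the number of all permutations $w\in S_n$ that satisfy $w(j)<w(j+1)$ for all $j\in Q_i$ and $w(j)>w(j+1)$ for all $j\in Q_i'$. (c) Write the set $Q_i$ in the form $Q_i=\{i_1<i_2<\cdots<i_p\}$, and set $i_0=1$ and $i_{p+1}=n+1$. Let $j_k=i_k-i_{k-1}$ for each $k\in[p+1]$. Then $$\delta_i=\binom{n}{j_1,j_2,\ldots,j_{p+1}}\cdot\prod_{k=2}^{p+1}(j_k-1),$$ where $\binom{n}{j_1,j_2,\ldots,j_{p+1}}=\frac{n!}{j_1!j_2!\cdots j_{p+1}!}$ is the multinomial coefficient. (d) $\delta_i\mid n!$.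
   Context: $\mathbb{N}=\{0,1,2,\ldots\}$; $[m]=\{1,\ldots,m\}$ (empty if $m\le 0$). $S_n$ is the group of permutations of $[n]$, with product $(\pi\sigma)(i)=\pi(\sigma(i))$; $\mathbf{k}[S_n]$ is its group algebra. For $i\in[n-1]$, $s_i\in S_n$ is the transposition swapping $i$ and $i+1$. For $w\in S_n$, $\operatorname{Des}w:=\{i\in[n-1]\mid w(i)>w(i+1)\}$. Fibonacci numbers: $f_0=0$, $f_1=1$, $f_m=f_{m-1}+f_{m-2}$. A set of integers is lacunar if it contains no two consecutive integers. For a finite set $I$ of integers, $\operatorname{sum}I$ is the sum of its elements. There are exactly $f_{n+1}$ lacunar subsets of $[n-1]$; fix a listing $Q_1,Q_2,\ldots,Q_{f_{n+1}}$ of all of them, without repetition, such that $\operatorname{sum}(Q_1)\le\cdots\le\operatorname{sum}(Q_{f_{n+1}})$. For $I\subseteq[n]$: $I':=\{i\in[n-1]\mid i\notin I\text{ and }i+1\notin I\}$ and $F(I):=\{q\in\mathbf{k}[S_n]\mid qs_i=q\text{ for all }i\in I'\}$. For $i\in\{0,1,\ldots,f_{n+1}\}$, $F_i:=F(Q_1)+F(Q_2)+\cdots+F(Q_i)$ (so $F_0=0$). For $w\in S_n$, $\operatorname{Qind}w$ is the smallest $i\in[f_{n+1}]$ such that $Q_i'\subseteq\operatorname{Des}w$ (such an $i$ always exists). *)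

theory Defs
  imports "HOL-Number_Theory.Fib" "HOL-Algebra.Algebra"
begin

section \<open>Group algebras, quotient modules, free modules\<close>

text \<open>
  The group algebra of a finite group: an element is its family of coefficients, extensional
  outside the group. The group is assumed finite, so there is no finite-support condition.
\<close>

definition group_algebra ::
  "('a, 'm) ring_scheme \<Rightarrow> ('g, 'h) monoid_scheme \<Rightarrow> ('a, 'g \<Rightarrow> 'a) module"
  where "group_algebra R G =
    \<lparr> carrier = carrier G \<rightarrow>\<^sub>E carrier R,
      monoid.mult = (\<lambda>p q. \<lambda>x\<in>carrier G.
        \<Oplus>\<^bsub>R\<^esub>y\<in>carrier G. p y \<otimes>\<^bsub>R\<^esub> q (inv\<^bsub>G\<^esub> y \<otimes>\<^bsub>G\<^esub> x)),
      monoid.one = (\<lambda>x\<in>carrier G. if x = \<one>\<^bsub>G\<^esub> then \<one>\<^bsub>R\<^esub> else \<zero>\<^bsub>R\<^esub>),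
      ring.zero = (\<lambda>x\<in>carrier G. \<zero>\<^bsub>R\<^esub>),
      ring.add = (\<lambda>p q. \<lambda>x\<in>carrier G. p x \<oplus>\<^bsub>R\<^esub> q x),
      module.smult = (\<lambda>a p. \<lambda>x\<in>carrier G. a \<otimes>\<^bsub>R\<^esub> p x) \<rparr>"

text \<open>The canonical map from the group to its group algebra.\<close>

definition ga_of ::
  "('a, 'm) ring_scheme \<Rightarrow> ('g, 'h) monoid_scheme \<Rightarrow> 'g \<Rightarrow> ('g \<Rightarrow> 'a)"
  where "ga_of R G g = (\<lambda>x\<in>carrier G. if x = g then \<one>\<^bsub>R\<^esub> else \<zero>\<^bsub>R\<^esub>)"

text \<open>
  The quotient of the module \<open>M\<close> by a submodule \<open>N\<close>. The record type of modules extends that of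
  rings, so \<open>mult\<close> and \<open>one\<close> have to be filled in, but they play no role for modules.
\<close>

definition quotient_module :: "('a, 'b, 'm) module_scheme \<Rightarrow> 'b set \<Rightarrow> ('a, 'b set) module"
  where "quotient_module M N =
    \<lparr> carrier = a_rcosets\<^bsub>M\<^esub> N,
      monoid.mult = (\<lambda>_ _. undefined),
      monoid.one = undefined,
      ring.zero = N,
      ring.add = set_add M,
      module.smult = (\<lambda>a C. \<Union>x\<in>C. N +>\<^bsub>M\<^esub> (a \<odot>\<^bsub>M\<^esub> x)) \<rparr>"

text \<open>
  \<open>M\<close> is a free \<open>R\<close>-module of rank \<open>d\<close>, i.e. it has a basis that is a family indexed by a
  \<open>d\<close>-element set. Using a family (instead of a set of vectors) makes this correct over the zero
  ring as well, over which the zero module is free of every rank.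
\<close>

definition free_of_rank ::
  "('a, 'm) ring_scheme \<Rightarrow> ('a, 'b, 'k) module_scheme \<Rightarrow> nat \<Rightarrow> bool"
  where "free_of_rank R M d \<longleftrightarrow> module R M \<and>
    (\<exists>b. b \<in> {..<d} \<rightarrow> carrier M \<and>
      (\<forall>x\<in>carrier M. \<exists>!c. c \<in> {..<d} \<rightarrow>\<^sub>E carrier R \<and>
        x = (\<Oplus>\<^bsub>M\<^esub>k\<in>{..<d}. c k \<odot>\<^bsub>M\<^esub> b k)))"


section \<open>Lacunar sets and the filtration of the symmetric group algebra\<close>

abbreviation kS :: "('a, 'm) ring_scheme \<Rightarrow> nat \<Rightarrow> ('a, (nat \<Rightarrow> nat) \<Rightarrow> 'a) module"
  where "kS R n \<equiv> group_algebra R (sym_group n)"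

definition lacunar :: "nat set \<Rightarrow> bool"
  where "lacunar I \<longleftrightarrow> (\<forall>i\<in>I. i + 1 \<notin> I)"

text \<open>For \<open>n = 0\<close>, truncated subtraction gives \<open>{1..n-1} = {}\<close>, as it should be.\<close>

definition Des :: "nat \<Rightarrow> (nat \<Rightarrow> nat) \<Rightarrow> nat set"
  where "Des n w = {i \<in> {1..n-1}. w i > w (i + 1)}"

text \<open>The set written \<open>I'\<close> in informal notation.\<close>

definition nonshadow :: "nat \<Rightarrow> nat set \<Rightarrow> nat set"
  where "nonshadow n I = {i \<in> {1..n-1}. i \<notin> I \<and> i + 1 \<notin> I}"

definition F_set :: "('a, 'm) ring_scheme \<Rightarrow> nat \<Rightarrow> nat set \<Rightarrow> ((nat \<Rightarrow> nat) \<Rightarrow> 'a) set"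
  where "F_set R n I = {q \<in> carrier (kS R n). \<forall>i\<in>nonshadow n I.
    q \<otimes>\<^bsub>kS R n\<^esub> ga_of R (sym_group n) (transpose i (i + 1)) = q}"

text \<open>\<open>Q 1, Q 2, \<dots>, Q (fib (n + 1))\<close> lists the lacunar subsets of \<open>{1..n-1}\<close> by weakly
  increasing sum.\<close>

definition lacunar_listing :: "nat \<Rightarrow> (nat \<Rightarrow> nat set) \<Rightarrow> bool"
  where "lacunar_listing n Q \<longleftrightarrow>
    bij_betw Q {1..fib (n + 1)} {I. I \<subseteq> {1..n-1} \<and> lacunar I} \<and>
    mono_on {1..fib (n + 1)} (\<lambda>k. \<Sum>(Q k))"

primrec F_filt ::
  "('a, 'm) ring_scheme \<Rightarrow> nat \<Rightarrow> (nat \<Rightarrow> nat set) \<Rightarrow> nat \<Rightarrow> ((nat \<Rightarrow> nat) \<Rightarrow> 'a) set"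
  where
    "F_filt R n Q 0 = {\<zero>\<^bsub>kS R n\<^esub>}"
  | "F_filt R n Q (Suc i) = F_filt R n Q i <+>\<^bsub>kS R n\<^esub> F_set R n (Q (Suc i))"

definition Qind :: "nat \<Rightarrow> (nat \<Rightarrow> nat set) \<Rightarrow> (nat \<Rightarrow> nat) \<Rightarrow> nat"
  where "Qind n Q w = (LEAST i. i \<in> {1..fib (n + 1)} \<and> nonshadow n (Q i) \<subseteq> Des n w)"

end

theory Submission
  imports Defs "HOL-Library.Infinite_Set"
begin

text \<open>
  Why the theorem holds. Say that a set \<open>A\<close> of positive integers covers \<open>t\<close> if \<open>t \<in> A\<close> or
  \<open>t + 1 \<in> A\<close>. Then \<open>I' \<subseteq> Des w\<close> says that \<open>I\<close> covers the ascents of \<open>w\<close>. Among all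
  sets covering a finite set \<open>T\<close>, a lacunar cover that is contained in \<open>T\<close> is the only one of
  minimal sum (\<open>lacunar_cover_minimal\<close>): going down from the largest element \<open>t\<close> of \<open>T\<close>, it pays
  to cover \<open>t\<close> by \<open>t\<close> itself, which also settles \<open>t - 1\<close>. Since the lacunar sets are listed by
  increasing sum, \<open>Qind w = i\<close> therefore means exactly that \<open>Q\<^sub>i\<close> consists of ascents of \<open>w\<close> and
  \<open>Q\<^sub>i'\<close> of descents of \<open>w\<close> (\<open>Qind_fibre\<close>). This is part (b).

  For part (a), attach to each permutation \<open>w\<close> the sum \<open>a\<^sub>w\<close> of its coset modulo the parabolic
  subgroup generated by the \<open>s\<^sub>j\<close> with \<open>j \<in> Des w\<close>. It is fixed by these \<open>s\<^sub>j\<close>. Order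
  permutations by the weight \<open>\<Sum>k. k * x k\<close>. Multiplying by \<open>s\<^sub>j\<close> at an ascent \<open>j\<close> lowers the
  weight, so an element of least weight in the support of a vector fixed by all \<open>s\<^sub>j\<close>, \<open>j \<in> J\<close>,
  has all of \<open>J\<close> among its descents. Two consequences: \<open>w\<close> is the unique element of least weight
  in the support of \<open>a\<^sub>w\<close>, which makes the \<open>a\<^sub>w\<close> linearly independent
  (\<open>coset_sum_independent\<close>), and the vectors fixed by all \<open>s\<^sub>j\<close>, \<open>j \<in> J\<close>, are spanned by the
  \<open>a\<^sub>w\<close> with \<open>J \<subseteq> Des w\<close> (\<open>right_invariants_eq_lincomb_set\<close>). Hence \<open>F\<^sub>i\<close> is spanned by the
  \<open>a\<^sub>w\<close> with \<open>Qind w \<le> i\<close> (\<open>F_filt_eq_lincomb_set\<close>), and the classes of those with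
  \<open>Qind w = i\<close> form a basis of \<open>F\<^sub>i / F\<^bsub>i-1\<^esub>\<close>.

  For part (c), cut \<open>[n]\<close> before each element of \<open>Q\<^sub>i\<close>. The conditions of part (b) then concern one
  block at a time, so one distributes the values among the blocks and arranges them inside each
  block (\<open>card_arrangements_UN\<close>). The first block has to be decreasing, which leaves one way. Each
  later block begins with an ascent and is decreasing afterwards: its first value is any but the
  largest, and this choice determines the rest. Part (d) follows since \<open>j! = (j - 1) * (j * (j - 2)!)\<close>
  for \<open>j \<ge> 2\<close>.
\<close>

section \<open>Covers of least sum and the index of a permutation\<close>

text \<open>
  By induction along \<open>T\<close>. Let \<open>t\<close> be the largest element of \<open>T\<close>. Then \<open>t + 1 \<notin> P\<close>, so \<open>t \<in> P\<close>,
  and \<open>P - {t}\<close> is a cover of the same kind of the elements below \<open>t - 1\<close>. The part of \<open>A\<close> below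
  \<open>t\<close> covers these elements as well, and the rest of \<open>A\<close> contains \<open>t\<close> or \<open>t + 1\<close>, so its sum is
  at least \<open>t\<close>, with equality only for \<open>{t}\<close>.
\<close>

lemma lacunar_cover_minimal:
  fixes P A T :: "nat set"
  assumes "finite T" "0 \<notin> T" "P \<subseteq> T" "lacunar P" "\<forall>t\<in>T. t \<in> P \<or> t + 1 \<in> P"
    and "finite A" "0 \<notin> A" "\<forall>t\<in>T. t \<in> A \<or> t + 1 \<in> A"
  shows "A = P \<or> \<Sum>P < \<Sum>A"
  using assms
proof (induction T arbitrary: P A rule: finite_psubset_induct)
  case (psubset T)
  have finP: "finite P" using psubset.hyps psubset.prems(2) finite_subset by blast
  show ?case
  proof (cases "T = {}")
    case True
    then have "P = {}" using psubset.prems(2) by auto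
    moreover have "\<Sum>A > 0" if "A \<noteq> {}"
    proof -
      from that obtain x where x: "x \<in> A" by auto
      then have "x \<le> \<Sum>A" using psubset.prems(5) member_le_sum[of x A "\<lambda>x. x"] by simp
      moreover have "x > 0" using x psubset.prems(6) by (cases x) auto
      ultimately show ?thesis by simp
    qed
    ultimately show ?thesis by (metis sum.empty)
  next
    case False
    define t where "t = Max T"
    define T' where "T' = {s \<in> T. s + 1 < t}"
    define A' where "A' = A \<inter> {..<t}"
    define B where "B = A \<inter> {t..}"
    have t: "t \<in> T" "\<And>s. s \<in> T \<Longrightarrow> s \<le> t" using False psubset.hyps by (auto simp: t_def)
    have tP: "t \<in> P" using t psubset.prems(2,4)
      by (metis Suc_eq_plus1 in_mono not_less_eq_eq)
    have "P - {t} \<subseteq> T'"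
    proof
      fix s assume s: "s \<in> P - {t}"
      then have "s \<in> T" "s < t" using psubset.prems(2) t(2)[of s] by auto
      moreover have "s + 1 \<noteq> t" using s tP psubset.prems(3) unfolding lacunar_def by auto
      ultimately show "s \<in> T'" unfolding T'_def by auto
    qed
    moreover have "T' \<subset> T"
    proof -
      have "t \<notin> T'" by (simp add: T'_def)
      then show ?thesis using t(1) unfolding T'_def by blast
    qed
    moreover have "0 \<notin> T'" "0 \<notin> A'" "finite A'" using psubset.prems(1,5,6) unfolding T'_def A'_def by auto
    moreover have "lacunar (P - {t})" using psubset.prems(3) unfolding lacunar_def by auto
    moreover have "\<forall>s\<in>T'. s \<in> P - {t} \<or> s + 1 \<in> P - {t}"
      using psubset.prems(4) unfolding T'_def by auto
    moreover have "\<forall>s\<in>T'. s \<in> A' \<or> s + 1 \<in> A'"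
      using psubset.prems(7) unfolding T'_def A'_def by auto
    ultimately have IH: "A' = P - {t} \<or> \<Sum>(P - {t}) < \<Sum>A'"
      using psubset.IH[of T' "P - {t}" A'] by blast
    have sumP: "\<Sum>P = \<Sum>(P - {t}) + t" using finP tP by (simp add: sum.remove[of P t])
    have AB: "A = A' \<union> B" unfolding A'_def B_def by (intro equalityI subsetI) (auto simp: not_less)
    have disj: "A' \<inter> B = {}" "finite B" "finite A'"
      using psubset.prems(5) by (simp_all add: A'_def B_def disjoint_iff)
    then have sumA: "\<Sum>A = \<Sum>A' + \<Sum>B" unfolding AB by (simp add: sum.union_disjoint)
    have tpos: "t > 0" using t(1) psubset.prems(1) by (cases t) auto
    have "B = {t} \<or> t < \<Sum>B"
    proof (cases "t \<in> B")
      case True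
      show ?thesis
      proof (cases "B = {t}")
        case False
        then obtain s where s: "s \<in> B" "s \<noteq> t" using True by blast
        then have "\<Sum>{s,t} \<le> \<Sum>B" using True disj(2) by (intro sum_mono2) auto
        then have "s + t \<le> \<Sum>B" using s by simp
        moreover have "s > 0" using s tpos by (auto simp: B_def)
        ultimately show ?thesis by simp
      qed simp
    next
      case False
      then have "t + 1 \<in> B" using t(1) psubset.prems(7) by (auto simp: B_def)
      then have "t + 1 \<le> \<Sum>B" using disj(2) member_le_sum[of "t+1" B "\<lambda>x. x"] by simp
      then show ?thesis by simp
    qed
    then show ?thesis
    proof (rule disjE)
      assume "B = {t}"
      then show ?thesis using IH sumP sumA AB tP by auto
    next
      assume "t < \<Sum>B"
      then show ?thesis using IH sumP sumA by auto
    qed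
  qed
qed

text \<open>Greedily: take the largest element \<open>t\<close>, discard \<open>t - 1\<close>, and continue below.\<close>

lemma lacunar_cover_exists:
  fixes T :: "nat set"
  assumes "finite T"
  shows "\<exists>P \<subseteq> T. lacunar P \<and> (\<forall>t\<in>T. t \<in> P \<or> t + 1 \<in> P)"
  using assms
proof (induction T rule: finite_psubset_induct)
  case (psubset T)
  show ?case
  proof (cases "T = {}")
    case True
    then show ?thesis by (auto simp: lacunar_def)
  next
    case False
    define t where "t = Max T"
    have t: "t \<in> T" "\<And>s. s \<in> T \<Longrightarrow> s \<le> t" using False psubset.hyps by (auto simp: t_def)
    have "t \<notin> {s \<in> T. s + 1 < t}" by simp
    then have "{s \<in> T. s + 1 < t} \<subset> T" using t(1) by blast
    then obtain P where P: "P \<subseteq> {s \<in> T. s + 1 < t}" "lacunar P"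
        "\<forall>s\<in>{s \<in> T. s + 1 < t}. s \<in> P \<or> s + 1 \<in> P"
      using psubset.IH by meson
    have "lacunar (insert t P)" using P(1,2) unfolding lacunar_def by fastforce
    moreover have "\<forall>s\<in>T. s \<in> insert t P \<or> s + 1 \<in> insert t P"
    proof
      fix s assume "s \<in> T"
      then show "s \<in> insert t P \<or> s + 1 \<in> insert t P"
        using P(3) t(2)[of s] by (cases "s + 1 < t") auto
    qed
    moreover have "insert t P \<subseteq> T" using P(1) t(1) by auto
    ultimately show ?thesis by blast
  qed
qed

lemma nonshadow_subset_Des_iff:
  assumes "I \<subseteq> {1..n-1}"
  shows "nonshadow n I \<subseteq> Des n w \<longleftrightarrow> (\<forall>t\<in>{1..n-1} - Des n w. t \<in> I \<or> t + 1 \<in> I)"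
  unfolding nonshadow_def by auto

text \<open>
  The lacunar cover \<open>P\<close> inside the set of ascents has strictly smaller sum than every other cover of
  the ascents, so it precedes all of them in any listing by weakly increasing sum, however ties are
  broken.
\<close>

lemma Qind_unique:
  assumes Q: "lacunar_listing n Q"
  obtains m where "m \<in> {1..fib (n + 1)}" "Qind n Q w = m"
    and "\<And>i. i \<in> {1..fib (n + 1)} \<Longrightarrow>
      i = m \<longleftrightarrow> Q i \<inter> Des n w = {} \<and> nonshadow n (Q i) \<subseteq> Des n w"
proof -
  let ?F = "{1..fib (n + 1)}"
  let ?T = "{1..n-1} - Des n w"
  have bij: "bij_betw Q ?F {I. I \<subseteq> {1..n-1} \<and> lacunar I}"
    and mono: "\<And>k l. \<lbrakk>k \<in> ?F; l \<in> ?F; k \<le> l\<rbrakk> \<Longrightarrow> \<Sum>(Q k) \<le> \<Sum>(Q l)"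
    using Q by (auto simp: lacunar_listing_def mono_on_def)
  have Qi: "Q i \<subseteq> {1..n-1}" "lacunar (Q i)" "finite (Q i)" "0 \<notin> Q i" if "i \<in> ?F" for i
    using bij_betwE[OF bij] that finite_subset[of "Q i" "{1..n-1}"] by fastforce+
  obtain P where P: "P \<subseteq> ?T" "lacunar P" "\<forall>t\<in>?T. t \<in> P \<or> t + 1 \<in> P"
    using lacunar_cover_exists[of ?T] by auto
  then have "P \<in> {I. I \<subseteq> {1..n-1} \<and> lacunar I}" by blast
  then have "P \<in> Q ` ?F" using bij by (simp add: bij_betw_def)
  then obtain m where m: "m \<in> ?F" "Q m = P" by blast
  have T: "finite ?T" "0 \<notin> ?T" by auto
  have finP: "finite P" "0 \<notin> P" using P(1) finite_subset by auto
  have min: "Q i = P \<or> \<Sum>P < \<Sum>(Q i)" if i: "i \<in> ?F" "nonshadow n (Q i) \<subseteq> Des n w" for i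
    using lacunar_cover_minimal[OF T P Qi(3,4)[OF i(1)]] i nonshadow_subset_Des_iff[OF Qi(1)[OF i(1)]]
    by blast
  have le: "m \<le> i" if i: "i \<in> ?F" "nonshadow n (Q i) \<subseteq> Des n w" for i
    using min[OF i] m i(1) mono[of i m] bij_betw_imp_inj_on[OF bij]
    by (metis inj_onD leD linorder_le_cases order_refl)
  have mns: "nonshadow n (Q m) \<subseteq> Des n w"
    using P(3) nonshadow_subset_Des_iff[OF Qi(1)[OF m(1)]] m(2) by blast
  have "Qind n Q w = m"
    unfolding Qind_def using m(1) mns le by (intro Least_equality) auto
  moreover have "i = m \<longleftrightarrow> Q i \<inter> Des n w = {} \<and> nonshadow n (Q i) \<subseteq> Des n w"
    if i: "i \<in> ?F" for i
  proof
    assume "i = m"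
    then show "Q i \<inter> Des n w = {} \<and> nonshadow n (Q i) \<subseteq> Des n w"
      using mns m(2) P(1) by auto
  next
    assume *: "Q i \<inter> Des n w = {} \<and> nonshadow n (Q i) \<subseteq> Des n w"
    then have "Q i \<subseteq> ?T" using Qi(1)[OF i] by auto
    moreover have "\<forall>t\<in>?T. t \<in> Q i \<or> t + 1 \<in> Q i"
      using * nonshadow_subset_Des_iff[OF Qi(1)[OF i]] by blast
    ultimately have "P = Q i \<or> \<Sum>(Q i) < \<Sum>P"
      using lacunar_cover_minimal[OF T _ Qi(2)[OF i] _ finP P(3)] by blast
    then have "Q i = P" using min[OF i] * by auto
    then show "i = m" using m i bij_betw_imp_inj_on[OF bij] by (metis inj_onD)
  qed
  ultimately show thesis using that m(1) by blast
qed


section \<open>Counting permutations block by block\<close>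

text \<open>
  Bijections from \<open>A\<close> onto \<open>V\<close>, continued by the identity outside \<open>A\<close>. With this convention the
  permutations of a set \<open>A\<close> are literally the case \<open>V = A\<close>, and functions on disjoint blocks can be
  glued; allowing \<open>V \<noteq> A\<close> makes standardization of the values unnecessary.
\<close>

definition arrangements :: "'a set \<Rightarrow> 'a set \<Rightarrow> (('a \<Rightarrow> 'a) \<Rightarrow> bool) \<Rightarrow> ('a \<Rightarrow> 'a) set"
  where "arrangements A V P = {w. bij_betw w A V \<and> (\<forall>x. x \<notin> A \<longrightarrow> w x = x) \<and> P w}"

definition local_to :: "'a set \<Rightarrow> (('a \<Rightarrow> 'a) \<Rightarrow> bool) \<Rightarrow> bool"
  where "local_to A P \<longleftrightarrow> (\<forall>w w'. (\<forall>x\<in>A. w x = w' x) \<longrightarrow> P w = P w')"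

lemma local_toD: "local_to A P \<Longrightarrow> (\<And>x. x \<in> A \<Longrightarrow> w x = w' x) \<Longrightarrow> P w = P w'"
  by (auto simp: local_to_def)

lemma arrangements_eqI:
  assumes "v \<in> arrangements A V P" "w \<in> arrangements A V' P'" "\<And>x. x \<in> A \<Longrightarrow> v x = w x"
  shows "v = w"
  using assms by (fastforce simp: arrangements_def)

lemma finite_arrangements:
  assumes "finite A" "finite V"
  shows "finite (arrangements A V P)"
proof (rule finite_imageD)
  show "finite ((\<lambda>w. restrict w A) ` arrangements A V P)"
    by (rule finite_subset[OF _ finite_PiE[of A "\<lambda>_. V"]])
       (use assms in \<open>auto simp: arrangements_def dest: bij_betwE\<close>)
  show "inj_on (\<lambda>w. restrict w A) (arrangements A V P)"
    by (rule inj_onI, rule arrangements_eqI) (assumption+, metis restrict_apply')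
qed

text \<open>Choose the set \<open>B\<close> of values taken on the first block; the two restrictions are then independent.\<close>

lemma card_arrangements_Un:
  assumes fin: "finite A1" "finite A2" "finite V" and disj: "A1 \<inter> A2 = {}"
    and cardV: "card V = card A1 + card A2"
    and loc: "local_to A1 P1" "local_to A2 P2"
    and N1: "\<And>B. \<lbrakk>finite B; card B = card A1\<rbrakk> \<Longrightarrow> card (arrangements A1 B P1) = N1"
    and N2: "\<And>B. \<lbrakk>finite B; card B = card A2\<rbrakk> \<Longrightarrow> card (arrangements A2 B P2) = N2"
  shows "card (arrangements (A1 \<union> A2) V (\<lambda>w. P1 w \<and> P2 w)) = (card V choose card A1) * N1 * N2"
proof -
  let ?X = "arrangements (A1 \<union> A2) V (\<lambda>w. P1 w \<and> P2 w)"
  let ?B = "{B. B \<subseteq> V \<and> card B = card A1}"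
  let ?Y = "SIGMA B:?B. arrangements A1 B P1 \<times> arrangements A2 (V - B) P2"
  define join :: "('a \<Rightarrow> 'a) \<Rightarrow> ('a \<Rightarrow> 'a) \<Rightarrow> 'a \<Rightarrow> 'a" where "join u v x = (if x \<in> A1 then u x else v x)" for u v x
  define part :: "'a set \<Rightarrow> ('a \<Rightarrow> 'a) \<Rightarrow> 'a \<Rightarrow> 'a" where "part A w x = (if x \<in> A then w x else x)" for A w x
  have "bij_betw (\<lambda>w. (w ` A1, part A1 w, part A2 w)) ?X ?Y"
  proof (rule bij_betw_byWitness[where f' = "\<lambda>(B, u, v). join u v"])
    show "\<forall>w\<in>?X. (case (w ` A1, part A1 w, part A2 w) of (B, u, v) \<Rightarrow> join u v) = w"
      by (auto simp: arrangements_def join_def part_def fun_eq_iff)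
    show "\<forall>y\<in>?Y. ((case y of (B, u, v) \<Rightarrow> join u v) ` A1, part A1 (case y of (B, u, v) \<Rightarrow> join u v),
        part A2 (case y of (B, u, v) \<Rightarrow> join u v)) = y"
    proof
      fix y assume "y \<in> ?Y"
      then obtain B u v where y: "y = (B, u, v)"
        and u: "u \<in> arrangements A1 B P1" and v: "v \<in> arrangements A2 (V - B) P2" by auto
      have "join u v ` A1 = u ` A1" by (auto simp: join_def)
      also have "\<dots> = B" using u by (auto simp: arrangements_def bij_betw_def)
      finally have 1: "join u v ` A1 = B" .
      have 2: "part A1 (join u v) = u" using u by (auto simp: part_def join_def arrangements_def)
      have 3: "part A2 (join u v) = v"
        using v disj by (intro ext) (auto simp: part_def join_def arrangements_def)
      show "((case y of (B, u, v) \<Rightarrow> join u v) ` A1, part A1 (case y of (B, u, v) \<Rightarrow> join u v),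
        part A2 (case y of (B, u, v) \<Rightarrow> join u v)) = y"
        using 1 2 3 y by simp
    qed
    show "(\<lambda>w. (w ` A1, part A1 w, part A2 w)) ` ?X \<subseteq> ?Y"
    proof
      fix y assume "y \<in> (\<lambda>w. (w ` A1, part A1 w, part A2 w)) ` ?X"
      then obtain w where w: "w \<in> ?X" and y: "y = (w ` A1, part A1 w, part A2 w)" by auto
      have bij: "bij_betw w (A1 \<union> A2) V" and P: "P1 w" "P2 w" using w by (auto simp: arrangements_def)
      have inj: "inj_on w (A1 \<union> A2)" and img: "w ` (A1 \<union> A2) = V" using bij by (auto simp: bij_betw_def)
      have inj1: "inj_on w A1" and inj2: "inj_on w A2" using inj by (auto intro: inj_on_subset)
      have "w ` A2 = V - w ` A1"
        using img inj disj by (auto simp: inj_on_def)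
      moreover have "w ` A1 \<in> ?B" using img inj1 by (auto simp: card_image)
      moreover have "bij_betw (part A1 w) A1 (w ` A1)" "bij_betw (part A2 w) A2 (w ` A2)"
        using inj1 inj2 by (auto simp: bij_betw_def part_def inj_on_def)
      moreover have "P1 (part A1 w)" "P2 (part A2 w)"
        using P local_toD[OF loc(1), of "part A1 w" w] local_toD[OF loc(2), of "part A2 w" w]
        by (auto simp: part_def)
      ultimately show "y \<in> ?Y" unfolding y by (auto simp: arrangements_def part_def)
    qed
    show "(\<lambda>(B, u, v). join u v) ` ?Y \<subseteq> ?X"
    proof
      fix w assume "w \<in> (\<lambda>(B, u, v). join u v) ` ?Y"
      then obtain B u v where w: "w = join u v" and B: "B \<subseteq> V" "card B = card A1"
        and u: "u \<in> arrangements A1 B P1" and v: "v \<in> arrangements A2 (V - B) P2" by auto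
      have ju: "\<And>x. x \<in> A1 \<Longrightarrow> join u v x = u x" and jv: "\<And>x. x \<in> A2 \<Longrightarrow> join u v x = v x"
        using disj by (auto simp: join_def)
      have "bij_betw (join u v) A1 B" "bij_betw (join u v) A2 (V - B)"
        using u v bij_betw_cong[of A1 "join u v" u B] bij_betw_cong[of A2 "join u v" v "V - B"] ju jv
        by (auto simp: arrangements_def)
      then have "bij_betw (join u v) (A1 \<union> A2) (B \<union> (V - B))" by (rule bij_betw_combine) auto
      then have "bij_betw (join u v) (A1 \<union> A2) V" using B(1) by (simp add: Un_absorb1)
      moreover have "P1 (join u v)" "P2 (join u v)"
        using u v local_toD[OF loc(1) ju] local_toD[OF loc(2) jv] by (auto simp: arrangements_def)
      ultimately show "w \<in> ?X"
        unfolding w using u v by (auto simp: arrangements_def join_def)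
    qed
  qed
  then have "card ?X = card ?Y" by (rule bij_betw_same_card)
  also have "\<dots> = (\<Sum>B\<in>?B. card (arrangements A1 B P1 \<times> arrangements A2 (V - B) P2))"
    using fin by (intro card_SigmaI) (auto intro!: finite_arrangements intro: finite_subset)
  also have "\<dots> = (\<Sum>B\<in>?B. N1 * N2)"
  proof (rule sum.cong)
    fix B assume "B \<in> ?B"
    then have B: "B \<subseteq> V" "card B = card A1" by auto
    then have fB: "finite B" using fin finite_subset by auto
    have "card (V - B) = card A2" using B fB cardV by (simp add: card_Diff_subset)
    then show "card (arrangements A1 B P1 \<times> arrangements A2 (V - B) P2) = N1 * N2"
      using B fB fin N1[of B] N2[of "V - B"] by (simp add: card_cartesian_product)
  qed simp
  also have "\<dots> = (card V choose card A1) * N1 * N2" using fin by (simp add: n_subsets)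
  finally show ?thesis .
qed

text \<open>
  Iterating the splitting, the binomial coefficients multiply up to a multinomial coefficient. It is
  stated without division so that it holds in the natural numbers.
\<close>

lemma card_arrangements_UN:
  assumes "finite K" "\<And>k. k \<in> K \<Longrightarrow> finite (A k)"
    and "\<And>k l. \<lbrakk>k \<in> K; l \<in> K; k \<noteq> l\<rbrakk> \<Longrightarrow> A k \<inter> A l = {}"
    and "\<And>k. k \<in> K \<Longrightarrow> local_to (A k) (P k)"
    and "\<And>k B. \<lbrakk>k \<in> K; finite B; card B = card (A k)\<rbrakk> \<Longrightarrow> card (arrangements (A k) B (P k)) = N k"
    and "finite V" "card V = (\<Sum>k\<in>K. card (A k))"
  shows "card (arrangements (\<Union>k\<in>K. A k) V (\<lambda>w. \<forall>k\<in>K. P k w)) * (\<Prod>k\<in>K. fact (card (A k)))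
    = fact (card V) * (\<Prod>k\<in>K. N k)"
  using assms
proof (induction K arbitrary: V rule: finite_induct)
  case empty
  then have "arrangements (\<Union>k\<in>{}. A k) V (\<lambda>w. \<forall>k\<in>{}. P k w) = {id}"
    by (auto simp: arrangements_def bij_betw_def)
  then show ?case using empty by simp
next
  case (insert k K)
  let ?U = "\<Union>l\<in>K. A l" and ?P = "\<lambda>w. \<forall>l\<in>K. P l w" and ?f = "\<Prod>l\<in>K. fact (card (A l)) :: nat"
  define M where "M = fact (card ?U) * (\<Prod>l\<in>K. N l) div ?f"
  have cU: "card ?U = (\<Sum>l\<in>K. card (A l))"
    using insert.prems insert.hyps by (intro card_UN_disjoint) auto
  have IH: "card (arrangements ?U B ?P) * ?f = fact (card ?U) * (\<Prod>l\<in>K. N l)"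
    if "finite B" "card B = card ?U" for B
    using insert.IH[of B] insert.prems that cU by auto
  have fpos: "?f > 0" by (simp add: prod_pos)
  have M: "card (arrangements ?U B ?P) = M" if "finite B" "card B = card ?U" for B
    unfolding M_def IH[OF that, symmetric] using fpos by simp
  have Mf: "M * ?f = fact (card ?U) * (\<Prod>l\<in>K. N l)"
    using IH[of ?U] M[of ?U] insert.hyps(1) insert.prems(1) by auto
  have cV: "card V = card (A k) + card ?U" using insert.prems(6) insert.hyps cU by simp
  have "card (arrangements (A k \<union> ?U) V (\<lambda>w. P k w \<and> ?P w)) = (card V choose card (A k)) * N k * M"
  proof (rule card_arrangements_Un)
    show "finite (A k)" "finite V" "finite ?U" using insert.prems insert.hyps by auto
    show "A k \<inter> ?U = {}" using insert.prems(2)[of k] insert.hyps(2) by (auto 4 4)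
    show "local_to (A k) (P k)" using insert.prems(3) by simp
    show "local_to ?U ?P"
      unfolding local_to_def using local_toD[OF insert.prems(3)] by (metis UN_I insertI2)
  qed (use cV M insert.prems(4) in auto)
  moreover have fact: "fact (card (A k)) * fact (card ?U) * (card V choose card (A k)) = (fact (card V) :: nat)"
    using binomial_fact_lemma[of "card (A k)" "card V"] cV by simp
  moreover have "(\<Union>l\<in>insert k K. A l) = A k \<union> ?U" "(\<lambda>w. \<forall>l\<in>insert k K. P l w) = (\<lambda>w. P k w \<and> ?P w)"
    by auto
  ultimately have "card (arrangements (\<Union>l\<in>insert k K. A l) V (\<lambda>w. \<forall>l\<in>insert k K. P l w)) * (fact (card (A k)) * ?f)
      = (fact (card (A k)) * (card V choose card (A k))) * N k * (M * ?f)"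
    by (simp only: mult_ac)
  also have "\<dots> = (fact (card (A k)) * fact (card ?U) * (card V choose card (A k))) * (N k * (\<Prod>l\<in>K. N l))"
    by (simp only: Mf mult_ac)
  also have "\<dots> = fact (card V) * (N k * (\<Prod>l\<in>K. N l))" by (simp only: fact)
  finally show ?case using insert.hyps by simp
qed

lemma descents_antimono:
  fixes x :: "nat \<Rightarrow> nat"
  assumes "\<And>j. \<lbrakk>k \<le> j; j < l\<rbrakk> \<Longrightarrow> x j > x (j + 1)" "k \<le> l"
  shows "x l \<le> x k"
  using assms(2,1)
proof (induction l rule: dec_induct)
  case (step l)
  then show ?case by (metis Suc_eq_plus1 le_trans less_Suc_eq less_imp_le_nat)
qed simp

text \<open>
  A function that decreases along each run of \<open>J\<close> is determined by the sets of values which it takes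
  on the runs. At the first difference \<open>m\<close>, say with \<open>x m < y m\<close>, the value \<open>y m\<close> must be taken by
  \<open>x\<close> within the run of \<open>m\<close>; but before \<open>m\<close> both functions agree, and from \<open>m\<close> on the values of
  \<open>x\<close> are at most \<open>x m\<close>. The lemma is used twice: with a single run to count decreasing
  arrangements, and with the runs of descents of a permutation to identify it within its coset.
\<close>

lemma eq_if_common_descents:
  fixes x y :: "nat \<Rightarrow> nat"
  assumes inj: "inj_on x {a..<b}" "inj_on y {a..<b}"
    and J: "\<And>j. j \<in> J \<Longrightarrow> j + 1 < b"
    and desc: "\<And>j. \<lbrakk>j \<in> J; a \<le> j\<rbrakk> \<Longrightarrow> x j > x (j + 1)" "\<And>j. \<lbrakk>j \<in> J; a \<le> j\<rbrakk> \<Longrightarrow> y j > y (j + 1)"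
    and img: "\<And>k. \<lbrakk>a \<le> k; k < b; k \<notin> J\<rbrakk> \<Longrightarrow> x ` {a..k} = y ` {a..k}"
    and j: "j \<in> {a..<b}"
  shows "x j = y j"
proof (rule ccontr)
  assume "x j \<noteq> y j"
  define m where "m = (LEAST m. m \<in> {a..<b} \<and> x m \<noteq> y m)"
  have m: "m \<in> {a..<b}" "x m \<noteq> y m"
    using LeastI[of "\<lambda>m. m \<in> {a..<b} \<and> x m \<noteq> y m" j] j \<open>x j \<noteq> y j\<close> by (auto simp: m_def)
  have below: "x l = y l" if "a \<le> l" "l < m" for l
    using not_less_Least[of l "\<lambda>m. m \<in> {a..<b} \<and> x m \<noteq> y m"] that m(1) by (auto simp: m_def)
  \<comment> \<open>The last position of the run of \<open>J\<close> through \<open>m\<close>.\<close>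
  define k where "k = (LEAST k. m \<le> k \<and> k \<notin> J)"
  have bJ: "b - 1 \<notin> J" using J[of "b - 1"] by auto
  then have "m \<le> b - 1 \<and> b - 1 \<notin> J" using m(1) by auto
  then have k: "m \<le> k" "k \<notin> J" "k \<le> b - 1"
    unfolding k_def
    by (metis (mono_tags, lifting) LeastI, metis (mono_tags, lifting) LeastI,
        metis (mono_tags, lifting) Least_le)
  have run: "i \<in> J" if "m \<le> i" "i < k" for i
    using not_less_Least[of i "\<lambda>k. m \<le> k \<and> k \<notin> J"] that by (auto simp: k_def)
  have kb: "k < b" using k(3) m(1) by auto
  have key: False
    if inj: "inj_on v {a..<b}" and less: "u m < v m" and uv: "u ` {a..k} = v ` {a..k}"
      and below: "\<And>l. \<lbrakk>a \<le> l; l < m\<rbrakk> \<Longrightarrow> u l = v l"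
      and desc: "\<And>j. \<lbrakk>j \<in> J; a \<le> j\<rbrakk> \<Longrightarrow> u j > u (j + 1)" for u v :: "nat \<Rightarrow> nat"
  proof -
    have "v m \<in> u ` {a..k}" unfolding uv using m(1) k(1) by auto
    then obtain l where l: "a \<le> l" "l \<le> k" "u l = v m" by auto
    show False
    proof (cases "l < m")
      case True
      then have "v l = v m" using below l by simp
      then show False using inj_onD[OF inj, of l m] True l(1) m(1) by auto
    next
      case False
      have "u l \<le> u m"
      proof (rule descents_antimono[where x = u and k = m and l = l])
        show "u j > u (j + 1)" if "m \<le> j" "j < l" for j
          using desc[OF run, of j] that l(2) m(1) by simp
      qed (use False in simp)
      then show False using less l(3) by simp
    qed
  qed
  have imk: "x ` {a..k} = y ` {a..k}" using img k(1,2) m(1) kb by auto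
  show False
  proof (cases "x m < y m")
    case True
    show False by (rule key[OF inj(2) True imk below desc(1)])
  next
    case False
    then have "y m < x m" using m(2) by simp
    then show False by (rule key[OF inj(1) _ imk[symmetric] below[symmetric] desc(2)])
  qed
qed

abbreviation (input) descending :: "nat \<Rightarrow> nat \<Rightarrow> (nat \<Rightarrow> nat) \<Rightarrow> bool"
  where "descending a b w \<equiv> \<forall>j. a \<le> j \<and> j + 1 < b \<longrightarrow> w j > w (j + 1)"

lemma card_descending_arrangements:
  assumes V: "finite V" "card V = b - a"
  shows "card (arrangements {a..<b} V (descending a b)) = 1"
proof -
  obtain h where h: "bij_betw h {..<card V} V" "strict_mono_on {..<card V} h"
    using ex_bij_betw_strict_mono_card[OF V(1)] by blast
  define w where "w j = (if j \<in> {a..<b} then h (b - 1 - j) else j)" for j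
  have "bij_betw (\<lambda>j. b - 1 - j) {a..<b} {..<b - a}"
    by (rule bij_betw_byWitness[where f' = "\<lambda>j. b - 1 - j"]) auto
  then have "bij_betw (h \<circ> (\<lambda>j. b - 1 - j)) {a..<b} V"
    using h(1) V(2) by (intro bij_betw_trans) auto
  then have "bij_betw w {a..<b} V"
    by (rule bij_betw_cong[THEN iffD1, rotated]) (auto simp: w_def)
  moreover have "descending a b w"
    using strict_mono_onD[OF h(2)] V(2) by (auto simp: w_def)
  ultimately have w: "w \<in> arrangements {a..<b} V (descending a b)"
    by (auto simp: arrangements_def w_def)
  moreover have "v = w" if v: "v \<in> arrangements {a..<b} V (descending a b)" for v
  proof (rule arrangements_eqI[OF v w])
    fix j assume "j \<in> {a..<b}"
    show "v j = w j"
    proof (rule eq_if_common_descents[where x = v and y = w and a = a and b = b and J = "{j. a \<le> j \<and> j + 1 < b}"])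
      show "inj_on v {a..<b}" "inj_on w {a..<b}" using v w by (auto simp: arrangements_def bij_betw_def)
      fix k assume k: "a \<le> k" "k < b" "k \<notin> {j. a \<le> j \<and> j + 1 < b}"
      then have "{a..k} = {a..<b}" by auto
      then show "v ` {a..k} = w ` {a..k}" using v w by (auto simp: arrangements_def bij_betw_def)
    qed (use v w \<open>j \<in> {a..<b}\<close> in \<open>auto simp: arrangements_def\<close>)
  qed
  ultimately have "arrangements {a..<b} V (descending a b) = {w}" by blast
  then show ?thesis by simp
qed

text \<open>
  Without the ascent condition there are \<open>b - a\<close> choices for the value at \<open>a\<close>, each completed in one
  way. Exactly one of these arrangements has a descent at \<open>a\<close>, namely the decreasing one.
\<close>

lemma card_ascent_descending_arrangements:
  assumes V: "finite V" "card V = b - a" and ab: "a + 2 \<le> b"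
  shows "card (arrangements {a..<b} V (\<lambda>w. w a < w (a + 1) \<and> descending (a + 1) b w)) = b - a - 1"
proof -
  let ?all = "arrangements {a..<b} V (descending (a + 1) b)"
  let ?asc = "arrangements {a..<b} V (\<lambda>w. w a < w (a + 1) \<and> descending (a + 1) b w)"
  let ?desc = "arrangements {a..<b} V (descending a b)"
  have one: "card (arrangements {a} B (\<lambda>_. True)) = 1" if "finite B" "card B = card {a}" for B
  proof -
    have "card B = 1" using that by simp
    then obtain v where "B = {v}" by (rule card_1_singletonE)
    then have "arrangements {a} B (\<lambda>_. True) = {\<lambda>x. if x = a then v else x}"
      by (auto simp: arrangements_def bij_betw_def fun_eq_iff)
    then show ?thesis by simp
  qed
  have "card (arrangements ({a} \<union> {a+1..<b}) V (\<lambda>w. True \<and> descending (a + 1) b w))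
      = (card V choose card {a}) * 1 * 1"
  proof (rule card_arrangements_Un)
    show "local_to {a+1..<b} (descending (a + 1) b)" by (auto simp: local_to_def)
    show "card (arrangements {a+1..<b} B (descending (a + 1) b)) = 1"
      if "finite B" "card B = card {a+1..<b}" for B
      using card_descending_arrangements[of B b "a+1"] that by simp
  qed (use V ab one in \<open>auto simp: local_to_def\<close>)
  moreover have "{a} \<union> {a+1..<b} = {a..<b}" using ab by auto
  ultimately have all: "card ?all = b - a" using V by simp
  have neq: "w a \<noteq> w (a + 1)" if "w \<in> ?all" for w
  proof -
    have "inj_on w {a..<b}" using that by (auto simp: arrangements_def bij_betw_def)
    then show ?thesis using ab by (auto dest: inj_onD[of w _ a "a + 1"])
  qed
  have split: "descending a b w \<longleftrightarrow> w a > w (a + 1) \<and> descending (a + 1) b w" for w :: "nat \<Rightarrow> nat"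
  proof
    assume R: "w a > w (a + 1) \<and> descending (a + 1) b w"
    show "descending a b w"
    proof (intro allI impI)
      fix j assume "a \<le> j \<and> j + 1 < b"
      then show "w j > w (j + 1)" using R by (cases "j = a") auto
    qed
  qed (use ab in auto)
  have "?all = ?asc \<union> ?desc" "?asc \<inter> ?desc = {}"
    using neq unfolding split by (auto simp: arrangements_def neq_iff)
  then have "card ?all = card ?asc + card ?desc"
    using V by (simp add: card_Un_disjoint finite_arrangements)
  then show ?thesis using all card_descending_arrangements[OF V] by simp
qed


section \<open>Spans, quotients and freeness\<close>

text \<open>
  The span of the family \<open>a\<close> on the index set \<open>S\<close>. As for \<^const>\<open>free_of_rank\<close>, families rather than
  sets of vectors are used, so that indices with equal vectors remain distinct.
\<close>

definition lincomb_set :: "('a, 'm) ring_scheme \<Rightarrow> ('a, 'b, 'k) module_scheme \<Rightarrow> ('i \<Rightarrow> 'b) \<Rightarrow> 'i set \<Rightarrow> 'b set"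
  where "lincomb_set R M a S = (\<lambda>c. \<Oplus>\<^bsub>M\<^esub>s\<in>S. c s \<odot>\<^bsub>M\<^esub> a s) ` (S \<rightarrow> carrier R)"

context module
begin

lemma lincomb_closed:
  assumes "c \<in> S \<rightarrow> carrier R" "a \<in> S \<rightarrow> carrier M"
  shows "(\<lambda>s. c s \<odot>\<^bsub>M\<^esub> a s) \<in> S \<rightarrow> carrier M"
  using assms by (auto simp: Pi_iff)

lemma lincomb_add:
  assumes "finite S" "c \<in> S \<rightarrow> carrier R" "d \<in> S \<rightarrow> carrier R" "a \<in> S \<rightarrow> carrier M"
  shows "(\<Oplus>\<^bsub>M\<^esub>s\<in>S. (c s \<oplus> d s) \<odot>\<^bsub>M\<^esub> a s)
    = (\<Oplus>\<^bsub>M\<^esub>s\<in>S. c s \<odot>\<^bsub>M\<^esub> a s) \<oplus>\<^bsub>M\<^esub> (\<Oplus>\<^bsub>M\<^esub>s\<in>S. d s \<odot>\<^bsub>M\<^esub> a s)"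
proof -
  have "(\<Oplus>\<^bsub>M\<^esub>s\<in>S. (c s \<oplus> d s) \<odot>\<^bsub>M\<^esub> a s) = (\<Oplus>\<^bsub>M\<^esub>s\<in>S. c s \<odot>\<^bsub>M\<^esub> a s \<oplus>\<^bsub>M\<^esub> d s \<odot>\<^bsub>M\<^esub> a s)"
    using assms by (intro M.finsum_cong') (auto simp: smult_l_distr Pi_iff)
  also have "\<dots> = (\<Oplus>\<^bsub>M\<^esub>s\<in>S. c s \<odot>\<^bsub>M\<^esub> a s) \<oplus>\<^bsub>M\<^esub> (\<Oplus>\<^bsub>M\<^esub>s\<in>S. d s \<odot>\<^bsub>M\<^esub> a s)"
    using assms by (intro M.finsum_addf lincomb_closed)
  finally show ?thesis .
qed

lemma lincomb_smult:
  assumes "finite S" "r \<in> carrier R" "c \<in> S \<rightarrow> carrier R" "a \<in> S \<rightarrow> carrier M"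
  shows "(\<Oplus>\<^bsub>M\<^esub>s\<in>S. (r \<otimes> c s) \<odot>\<^bsub>M\<^esub> a s) = r \<odot>\<^bsub>M\<^esub> (\<Oplus>\<^bsub>M\<^esub>s\<in>S. c s \<odot>\<^bsub>M\<^esub> a s)"
proof -
  have "(\<Oplus>\<^bsub>M\<^esub>s\<in>S. (r \<otimes> c s) \<odot>\<^bsub>M\<^esub> a s) = (\<Oplus>\<^bsub>M\<^esub>s\<in>S. r \<odot>\<^bsub>M\<^esub> (c s \<odot>\<^bsub>M\<^esub> a s))"
    using assms by (intro M.finsum_cong') (auto simp: smult_assoc1 Pi_iff)
  also have "\<dots> = r \<odot>\<^bsub>M\<^esub> (\<Oplus>\<^bsub>M\<^esub>s\<in>S. c s \<odot>\<^bsub>M\<^esub> a s)"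
    using assms by (intro finsum_smult_ldistr[symmetric] lincomb_closed)
  finally show ?thesis .
qed

lemma lincomb_set_submodule:
  assumes S: "finite S" and a: "a \<in> S \<rightarrow> carrier M"
  shows "submodule (lincomb_set R M a S) R M"
proof (rule submoduleI)
  show "lincomb_set R M a S \<subseteq> carrier M"
    unfolding lincomb_set_def using a by (auto intro!: M.finsum_closed lincomb_closed)
  have "(\<Oplus>\<^bsub>M\<^esub>s\<in>S. \<zero> \<odot>\<^bsub>M\<^esub> a s) = \<zero>\<^bsub>M\<^esub>"
    using a by (intro M.add.finprod_one_eqI) (simp add: Pi_iff)
  then show "\<zero>\<^bsub>M\<^esub> \<in> lincomb_set R M a S"
    unfolding lincomb_set_def by (intro image_eqI[where x = "\<lambda>_. \<zero>"]) auto
  show smult: "r \<odot>\<^bsub>M\<^esub> x \<in> lincomb_set R M a S" if "r \<in> carrier R" "x \<in> lincomb_set R M a S" for r x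
  proof -
    from that(2) obtain c where c: "c \<in> S \<rightarrow> carrier R" "x = (\<Oplus>\<^bsub>M\<^esub>s\<in>S. c s \<odot>\<^bsub>M\<^esub> a s)"
      unfolding lincomb_set_def by auto
    have "r \<odot>\<^bsub>M\<^esub> x = (\<Oplus>\<^bsub>M\<^esub>s\<in>S. (r \<otimes> c s) \<odot>\<^bsub>M\<^esub> a s)"
      using lincomb_smult[OF S that(1) c(1) a] c(2) by simp
    then show ?thesis unfolding lincomb_set_def
      using c(1) that(1) by (intro image_eqI[where x = "\<lambda>s. r \<otimes> c s"]) auto
  qed
  show "x \<oplus>\<^bsub>M\<^esub> y \<in> lincomb_set R M a S" if "x \<in> lincomb_set R M a S" "y \<in> lincomb_set R M a S" for x y
  proof -
    from that obtain c d where c: "c \<in> S \<rightarrow> carrier R" "x = (\<Oplus>\<^bsub>M\<^esub>s\<in>S. c s \<odot>\<^bsub>M\<^esub> a s)"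
      and d: "d \<in> S \<rightarrow> carrier R" "y = (\<Oplus>\<^bsub>M\<^esub>s\<in>S. d s \<odot>\<^bsub>M\<^esub> a s)"
      unfolding lincomb_set_def by auto
    have "x \<oplus>\<^bsub>M\<^esub> y = (\<Oplus>\<^bsub>M\<^esub>s\<in>S. (c s \<oplus> d s) \<odot>\<^bsub>M\<^esub> a s)"
      using lincomb_add[OF S c(1) d(1) a] c(2) d(2) by simp
    then show ?thesis unfolding lincomb_set_def
      using c(1) d(1) by (intro image_eqI[where x = "\<lambda>s. c s \<oplus> d s"]) auto
  qed
  show "\<ominus>\<^bsub>M\<^esub> x \<in> lincomb_set R M a S" if "x \<in> lincomb_set R M a S" for x
  proof -
    have "x \<in> carrier M" using that \<open>lincomb_set R M a S \<subseteq> carrier M\<close> by auto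
    then have "\<ominus>\<^bsub>M\<^esub> x = (\<ominus> \<one>) \<odot>\<^bsub>M\<^esub> x" by (simp add: smult_l_minus)
    then show ?thesis using smult[of "\<ominus> \<one>" x] that by simp
  qed
qed

lemma lincomb_set_base:
  assumes S: "finite S" and a: "a \<in> S \<rightarrow> carrier M" and s: "s \<in> S"
  shows "a s \<in> lincomb_set R M a S"
proof -
  have "(\<Oplus>\<^bsub>M\<^esub>t\<in>S. (if s = t then \<one> else \<zero>) \<odot>\<^bsub>M\<^esub> a t) = (\<Oplus>\<^bsub>M\<^esub>t\<in>S. if s = t then a t else \<zero>\<^bsub>M\<^esub>)"
    using a by (intro M.finsum_cong') (auto simp: Pi_iff)
  also have "\<dots> = a s" using S a s by (intro M.finsum_singleton) auto
  finally show ?thesis unfolding lincomb_set_def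
    by (intro image_eqI[where x = "\<lambda>t. if s = t then \<one> else \<zero>"]) auto
qed

lemma submodule_finsum_closed:
  assumes N: "submodule N R M" and f: "f \<in> S \<rightarrow> N"
  shows "(\<Oplus>\<^bsub>M\<^esub>s\<in>S. f s) \<in> N"
proof -
  note NE = submoduleE[OF N]
  have 0: "\<zero>\<^bsub>M\<^esub> \<in> N"
    using NE(2) NE(4)[of \<zero>] NE(1) by fastforce
  show ?thesis
  proof (cases "finite S")
    case True
    then show ?thesis using f
    proof (induction S rule: finite_induct)
      case (insert s S)
      then have "f \<in> S \<rightarrow> carrier M" "f s \<in> carrier M" using NE(1) by auto
      then show ?case using insert NE(5) by auto
    qed (simp add: 0)
  qed (simp add: 0 M.finsum_infinite)
qed

lemma lincomb_set_least:
  assumes N: "submodule N R M" and a: "a \<in> S \<rightarrow> N"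
  shows "lincomb_set R M a S \<subseteq> N"
proof -
  have "(\<Oplus>\<^bsub>M\<^esub>s\<in>S. c s \<odot>\<^bsub>M\<^esub> a s) \<in> N" if "c \<in> S \<rightarrow> carrier R" for c
    using that a submoduleE(4)[OF N] by (intro submodule_finsum_closed[OF N]) auto
  then show ?thesis unfolding lincomb_set_def by auto
qed

lemma submodule_abelian_subgroup:
  assumes "submodule N R M"
  shows "abelian_subgroup N M"
  using assms by (intro abelian_subgroupI3 additive_subgroupI)
     (auto simp: submodule_def M.abelian_group_axioms)

lemma quotient_module_smult:
  assumes N: "submodule N R M" and r: "r \<in> carrier R" and x: "x \<in> carrier M"
  shows "r \<odot>\<^bsub>quotient_module M N\<^esub> (N +>\<^bsub>M\<^esub> x) = N +>\<^bsub>M\<^esub> (r \<odot>\<^bsub>M\<^esub> x)"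
proof -
  interpret N: abelian_subgroup N M using submodule_abelian_subgroup[OF N] .
  note NE = submoduleE[OF N]
  have "N +>\<^bsub>M\<^esub> (r \<odot>\<^bsub>M\<^esub> y) = N +>\<^bsub>M\<^esub> (r \<odot>\<^bsub>M\<^esub> x)" if y: "y \<in> N +>\<^bsub>M\<^esub> x" for y
  proof -
    obtain h where h: "h \<in> N" "y = h \<oplus>\<^bsub>M\<^esub> x" using y unfolding a_r_coset_def' by auto
    have hM: "h \<in> carrier M" using h(1) NE(1) by auto
    have "r \<odot>\<^bsub>M\<^esub> y = r \<odot>\<^bsub>M\<^esub> h \<oplus>\<^bsub>M\<^esub> r \<odot>\<^bsub>M\<^esub> x" using h hM r x by (simp add: smult_r_distr)
    moreover have "r \<odot>\<^bsub>M\<^esub> h \<in> N" using NE(4)[OF r h(1)] .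
    ultimately have "r \<odot>\<^bsub>M\<^esub> y \<in> N +>\<^bsub>M\<^esub> (r \<odot>\<^bsub>M\<^esub> x)" unfolding a_r_coset_def' by auto
    then show ?thesis using N.a_repr_independence' r x by (metis smult_closed)
  qed
  then have const: "\<forall>y\<in>N +>\<^bsub>M\<^esub> x. N +>\<^bsub>M\<^esub> (r \<odot>\<^bsub>M\<^esub> y) = N +>\<^bsub>M\<^esub> (r \<odot>\<^bsub>M\<^esub> x)" by blast
  have "x \<in> N +>\<^bsub>M\<^esub> x" using x N.a_rcos_self by simp
  then have "(\<Union>y\<in>N +>\<^bsub>M\<^esub> x. N +>\<^bsub>M\<^esub> (r \<odot>\<^bsub>M\<^esub> y)) = N +>\<^bsub>M\<^esub> (r \<odot>\<^bsub>M\<^esub> x)"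
    using const by (rule UN_constant_eq)
  then show ?thesis by (simp add: quotient_module_def)
qed

lemma quotient_module_simps:
  shows "carrier (quotient_module M N) = a_rcosets\<^bsub>M\<^esub> N"
    and "\<zero>\<^bsub>quotient_module M N\<^esub> = N"
    and "C \<oplus>\<^bsub>quotient_module M N\<^esub> D = C <+>\<^bsub>M\<^esub> D"
  by (simp_all add: quotient_module_def)

lemma quotient_module_is_module:
  assumes N: "submodule N R M"
  shows "module R (quotient_module M N)"
proof (rule moduleI)
  interpret N: abelian_subgroup N M using submodule_abelian_subgroup[OF N] .
  let ?Q = "quotient_module M N"
  have rep: "\<exists>x\<in>carrier M. U = N +>\<^bsub>M\<^esub> x" if "U \<in> carrier ?Q" for U
    using that by (auto simp: quotient_module_simps A_RCOSETS_def')
  have mem: "N +>\<^bsub>M\<^esub> x \<in> carrier ?Q" if "x \<in> carrier M" for x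
    using that by (auto simp: quotient_module_simps A_RCOSETS_def')
  note smult = quotient_module_smult[OF N]
  have add: "(N +>\<^bsub>M\<^esub> x) \<oplus>\<^bsub>?Q\<^esub> (N +>\<^bsub>M\<^esub> y) = N +>\<^bsub>M\<^esub> (x \<oplus>\<^bsub>M\<^esub> y)"
    if "x \<in> carrier M" "y \<in> carrier M" for x y
    using that N.a_rcos_sum by (simp add: quotient_module_simps)
  show "cring R" by (rule R.cring_axioms)
  show "abelian_group ?Q"
  proof (rule abelian_groupI)
    show "\<zero>\<^bsub>?Q\<^esub> \<in> carrier ?Q"
      using N.a_subgroup_in_rcosets by (simp add: quotient_module_simps)
    show "U \<oplus>\<^bsub>?Q\<^esub> Y \<in> carrier ?Q" if "U \<in> carrier ?Q" "Y \<in> carrier ?Q" for U Y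
      using rep[OF that(1)] rep[OF that(2)] add mem by auto
    show "U \<oplus>\<^bsub>?Q\<^esub> Y \<oplus>\<^bsub>?Q\<^esub> Z = U \<oplus>\<^bsub>?Q\<^esub> (Y \<oplus>\<^bsub>?Q\<^esub> Z)"
      if "U \<in> carrier ?Q" "Y \<in> carrier ?Q" "Z \<in> carrier ?Q" for U Y Z
      using rep[OF that(1)] rep[OF that(2)] rep[OF that(3)] add by (auto simp: M.a_assoc)
    show "U \<oplus>\<^bsub>?Q\<^esub> Y = Y \<oplus>\<^bsub>?Q\<^esub> U" if "U \<in> carrier ?Q" "Y \<in> carrier ?Q" for U Y
      using rep[OF that(1)] rep[OF that(2)] add by (auto simp: M.a_comm)
    show "\<zero>\<^bsub>?Q\<^esub> \<oplus>\<^bsub>?Q\<^esub> U = U" if "U \<in> carrier ?Q" for U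
      using that N.rcosets_add_eq by (simp add: quotient_module_simps)
    show "\<exists>Y\<in>carrier ?Q. Y \<oplus>\<^bsub>?Q\<^esub> U = \<zero>\<^bsub>?Q\<^esub>" if U: "U \<in> carrier ?Q" for U
    proof -
      obtain x where x: "x \<in> carrier M" "U = N +>\<^bsub>M\<^esub> x" using rep[OF U] by auto
      have "(N +>\<^bsub>M\<^esub> (\<ominus>\<^bsub>M\<^esub> x)) \<oplus>\<^bsub>?Q\<^esub> U = N +>\<^bsub>M\<^esub> \<zero>\<^bsub>M\<^esub>"
        using x add by (simp add: M.l_neg)
      also have "\<dots> = \<zero>\<^bsub>?Q\<^esub>" using submoduleE(1)[OF N] by (simp add: quotient_module_simps M.a_coset_add_zero)
      finally show ?thesis using mem x by (meson M.a_inv_closed)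
    qed
  qed
  show "\<one> \<odot>\<^bsub>?Q\<^esub> U = U" if U: "U \<in> carrier ?Q" for U
    using rep[OF U] smult by auto
  show "r \<odot>\<^bsub>?Q\<^esub> U \<in> carrier ?Q" if r: "r \<in> carrier R" and U: "U \<in> carrier ?Q" for r U
    using rep[OF U] smult mem r by auto
  show "(r \<oplus> s) \<odot>\<^bsub>?Q\<^esub> U = r \<odot>\<^bsub>?Q\<^esub> U \<oplus>\<^bsub>?Q\<^esub> s \<odot>\<^bsub>?Q\<^esub> U"
    if r: "r \<in> carrier R" and s: "s \<in> carrier R" and U: "U \<in> carrier ?Q" for r s U
    using rep[OF U] smult add r s by (auto simp: smult_l_distr)
  show "(r \<otimes> s) \<odot>\<^bsub>?Q\<^esub> U = r \<odot>\<^bsub>?Q\<^esub> (s \<odot>\<^bsub>?Q\<^esub> U)"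
    if r: "r \<in> carrier R" and s: "s \<in> carrier R" and U: "U \<in> carrier ?Q" for r s U
    using rep[OF U] smult r s by (auto simp: smult_assoc1)
  show "r \<odot>\<^bsub>?Q\<^esub> (U \<oplus>\<^bsub>?Q\<^esub> Y) = r \<odot>\<^bsub>?Q\<^esub> U \<oplus>\<^bsub>?Q\<^esub> r \<odot>\<^bsub>?Q\<^esub> Y"
    if r: "r \<in> carrier R" and U: "U \<in> carrier ?Q" and Y: "Y \<in> carrier ?Q" for r U Y
  proof -
    obtain x y where x: "x \<in> carrier M" "U = N +>\<^bsub>M\<^esub> x" and y: "y \<in> carrier M" "Y = N +>\<^bsub>M\<^esub> y"
      using rep[OF U] rep[OF Y] by blast
    show ?thesis
      unfolding x(2) y(2)
      by (simp only: add smult x(1) y(1) r M.a_closed smult_closed smult_r_distr)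
  qed
qed

lemma quotient_module_finsum:
  assumes N: "submodule N R M" and S: "finite S" and f: "f \<in> S \<rightarrow> carrier M"
  shows "(\<Oplus>\<^bsub>quotient_module M N\<^esub>s\<in>S. N +>\<^bsub>M\<^esub> f s) = N +>\<^bsub>M\<^esub> (\<Oplus>\<^bsub>M\<^esub>s\<in>S. f s)"
proof -
  interpret N: abelian_subgroup N M using submodule_abelian_subgroup[OF N] .
  interpret Q: module R "quotient_module M N" by (rule quotient_module_is_module[OF N])
  show ?thesis using S f
  proof (induction S rule: finite_induct)
    case empty
    then show ?case using submoduleE(1)[OF N]
      by (simp add: quotient_module_simps M.a_coset_add_zero)
  next
    case (insert s S)
    have mem: "N +>\<^bsub>M\<^esub> x \<in> carrier (quotient_module M N)" if "x \<in> carrier M" for x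
      using that by (auto simp: quotient_module_simps A_RCOSETS_def')
    show ?case using insert mem N.a_rcos_sum by (simp add: Pi_iff quotient_module_simps(3))
  qed
qed

lemma finsum_submodule:
  assumes N: "submodule N R M" and S: "finite S" and f: "f \<in> S \<rightarrow> N"
  shows "(\<Oplus>\<^bsub>M\<lparr>carrier := N\<rparr>\<^esub>s\<in>S. f s) = (\<Oplus>\<^bsub>M\<^esub>s\<in>S. f s)"
proof -
  interpret N: module R "M\<lparr>carrier := N\<rparr>"
    using submodule.submodule_is_module[OF N] module_axioms by simp
  show ?thesis using S f
  proof (induction S rule: finite_induct)
    case (insert s S)
    then have "f \<in> S \<rightarrow> carrier M" "f s \<in> carrier M" using submoduleE(1)[OF N] by auto
    then show ?case using insert by (simp add: Pi_iff)
  qed simp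
qed

lemma submodule_in_submodule:
  assumes N: "submodule N R M" and N': "submodule N' R M" and "N \<subseteq> N'"
  shows "submodule N R (M\<lparr>carrier := N'\<rparr>)"
proof -
  interpret N': module R "M\<lparr>carrier := N'\<rparr>"
    using submodule.submodule_is_module[OF N'] module_axioms by simp
  have "module R (M\<lparr>carrier := N\<rparr>)"
    using submodule.submodule_is_module[OF N] module_axioms by simp
  then show ?thesis using N'.module_incl_imp_submodule[of N] assms(3) by simp
qed

text \<open>
  If \<open>a\<close> is linearly independent on \<open>S\<close> and \<open>T \<subseteq> S\<close>, then the classes of the remaining vectors form
  a basis of the quotient of the two spans: deleting the terms from \<open>T\<close> does not change the class of
  a combination, and a relation between the classes becomes, after lifting, a relation on \<open>S\<close>.
\<close>

lemma free_of_rank_quotient_lincomb_set: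
  assumes S: "finite S" and TS: "T \<subseteq> S" and a: "a \<in> S \<rightarrow> carrier M"
    and indep: "\<And>c. \<lbrakk>c \<in> S \<rightarrow> carrier R; (\<Oplus>\<^bsub>M\<^esub>s\<in>S. c s \<odot>\<^bsub>M\<^esub> a s) = \<zero>\<^bsub>M\<^esub>\<rbrakk>
      \<Longrightarrow> \<forall>s\<in>S. c s = \<zero>"
  shows "free_of_rank R (quotient_module (M\<lparr>carrier := lincomb_set R M a S\<rparr>) (lincomb_set R M a T))
    (card (S - T))"
proof -
  define L where "L = M\<lparr>carrier := lincomb_set R M a S\<rparr>"
  define N where "N = lincomb_set R M a T"
  define q where "q = quotient_module L N"
  have T: "finite T" "a \<in> T \<rightarrow> carrier M" using S TS a finite_subset by auto
  have subS: "submodule (lincomb_set R M a S) R M" using lincomb_set_submodule[OF S a] .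
  have subT: "submodule N R M" unfolding N_def using lincomb_set_submodule[OF T] .
  have NS: "N \<subseteq> lincomb_set R M a S" unfolding N_def
    using lincomb_set_base[OF S a] TS by (intro lincomb_set_least[OF subS]) auto
  interpret L: module R L unfolding L_def
    using submodule.submodule_is_module[OF subS] module_axioms by simp
  have subL: "submodule N R L" unfolding L_def using submodule_in_submodule[OF subT subS NS] .
  interpret q: module R q unfolding q_def using L.quotient_module_is_module[OF subL] .
  interpret NL: abelian_subgroup N L using L.submodule_abelian_subgroup[OF subL] .
  obtain e where e: "bij_betw e {..<card (S - T)} (S - T)"
    using ex_bij_betw_nat_finite[of "S - T"] S by (auto simp: atLeast0LessThan)
  let ?d = "card (S - T)"
  have eS: "e k \<in> S" "e k \<notin> T" if "k < ?d" for k using bij_betwE[OF e] that by auto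
  have aL: "a s \<in> carrier L" if "s \<in> S" for s unfolding L_def using lincomb_set_base[OF S a that] by simp
  define b where "b k = N +>\<^bsub>L\<^esub> a (e k)" for k
  have bq: "b \<in> {..<?d} \<rightarrow> carrier q"
    using aL eS by (force simp: b_def q_def quotient_module_def A_RCOSETS_def')
  have cls: "(\<Oplus>\<^bsub>q\<^esub>k\<in>{..<?d}. c k \<odot>\<^bsub>q\<^esub> b k) = N +>\<^bsub>L\<^esub> (\<Oplus>\<^bsub>M\<^esub>k\<in>{..<?d}. c k \<odot>\<^bsub>M\<^esub> a (e k))"
    if c: "c \<in> {..<?d} \<rightarrow> carrier R" for c
  proof -
    have "(\<Oplus>\<^bsub>q\<^esub>k\<in>{..<?d}. c k \<odot>\<^bsub>q\<^esub> b k) = (\<Oplus>\<^bsub>q\<^esub>k\<in>{..<?d}. N +>\<^bsub>L\<^esub> (c k \<odot>\<^bsub>L\<^esub> a (e k)))"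
    proof (rule q.M.finsum_cong')
      show "c k \<odot>\<^bsub>q\<^esub> b k = N +>\<^bsub>L\<^esub> (c k \<odot>\<^bsub>L\<^esub> a (e k))" if "k \<in> {..<?d}" for k
        unfolding q_def b_def using c that aL eS by (intro L.quotient_module_smult[OF subL]) auto
      show "(\<lambda>k. N +>\<^bsub>L\<^esub> (c k \<odot>\<^bsub>L\<^esub> a (e k))) \<in> {..<?d} \<rightarrow> carrier q"
        using c aL eS by (auto simp: q_def quotient_module_def A_RCOSETS_def' Pi_iff)
    qed simp
    also have "\<dots> = N +>\<^bsub>L\<^esub> (\<Oplus>\<^bsub>L\<^esub>k\<in>{..<?d}. c k \<odot>\<^bsub>L\<^esub> a (e k))"
      unfolding q_def using c aL eS by (intro L.quotient_module_finsum[OF subL]) auto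
    also have "(\<Oplus>\<^bsub>L\<^esub>k\<in>{..<?d}. c k \<odot>\<^bsub>L\<^esub> a (e k)) = (\<Oplus>\<^bsub>M\<^esub>k\<in>{..<?d}. c k \<odot>\<^bsub>L\<^esub> a (e k))"
      using c aL eS L.smult_closed unfolding L_def by (intro finsum_submodule[OF subS]) (auto simp: Pi_iff)
    also have "\<dots> = (\<Oplus>\<^bsub>M\<^esub>k\<in>{..<?d}. c k \<odot>\<^bsub>M\<^esub> a (e k))" by (simp add: L_def)
    finally show ?thesis .
  qed
  have reindex: "(\<Oplus>\<^bsub>M\<^esub>s\<in>S-T. c s \<odot>\<^bsub>M\<^esub> a s) = (\<Oplus>\<^bsub>M\<^esub>k\<in>{..<?d}. c (e k) \<odot>\<^bsub>M\<^esub> a (e k))"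
    if c: "c \<in> S - T \<rightarrow> carrier R" for c
  proof -
    have img: "e ` {..<?d} = S - T" and inj: "inj_on e {..<?d}" using e by (auto simp: bij_betw_def)
    have "(\<lambda>s. c s \<odot>\<^bsub>M\<^esub> a s) \<in> e ` {..<?d} \<rightarrow> carrier M" using c a img by auto
    from M.finsum_reindex[OF this inj] show ?thesis using img by simp
  qed
  have split: "(\<Oplus>\<^bsub>M\<^esub>s\<in>S. c s \<odot>\<^bsub>M\<^esub> a s)
      = (\<Oplus>\<^bsub>M\<^esub>s\<in>T. c s \<odot>\<^bsub>M\<^esub> a s) \<oplus>\<^bsub>M\<^esub> (\<Oplus>\<^bsub>M\<^esub>s\<in>S-T. c s \<odot>\<^bsub>M\<^esub> a s)" 
    if c: "c \<in> S \<rightarrow> carrier R" for c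
  proof -
    have "S = T \<union> (S - T)" using TS by auto
    then show ?thesis
      using M.finsum_Un_disjoint[of T "S - T" "\<lambda>s. c s \<odot>\<^bsub>M\<^esub> a s"] S T c a TS
      by (auto simp: Pi_iff subset_iff)
  qed
  have ex: "\<exists>c. c \<in> {..<?d} \<rightarrow>\<^sub>E carrier R \<and> U = (\<Oplus>\<^bsub>q\<^esub>k\<in>{..<?d}. c k \<odot>\<^bsub>q\<^esub> b k)"
    if U: "U \<in> carrier q" for U
  proof -
    obtain x where x: "x \<in> carrier L" "U = N +>\<^bsub>L\<^esub> x"
      using U by (auto simp: q_def quotient_module_def A_RCOSETS_def')
    then obtain c where c: "c \<in> S \<rightarrow> carrier R" "x = (\<Oplus>\<^bsub>M\<^esub>s\<in>S. c s \<odot>\<^bsub>M\<^esub> a s)"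
      by (auto simp: L_def lincomb_set_def)
    define y where "y = (\<Oplus>\<^bsub>M\<^esub>s\<in>S-T. c s \<odot>\<^bsub>M\<^esub> a s)"
    define c' where "c' = (\<lambda>k\<in>{..<?d}. c (e k))"
    have c': "c' \<in> {..<?d} \<rightarrow>\<^sub>E carrier R" using c(1) eS by (auto simp: c'_def)
    have "(\<Oplus>\<^bsub>M\<^esub>k\<in>{..<?d}. c' k \<odot>\<^bsub>M\<^esub> a (e k)) = (\<Oplus>\<^bsub>M\<^esub>k\<in>{..<?d}. c (e k) \<odot>\<^bsub>M\<^esub> a (e k))"
      using c(1) a eS by (intro M.finsum_cong') (auto simp: c'_def Pi_iff)
    also have "\<dots> = y" unfolding y_def using c(1) by (intro reindex[symmetric]) auto
    finally have y': "(\<Oplus>\<^bsub>M\<^esub>k\<in>{..<?d}. c' k \<odot>\<^bsub>M\<^esub> a (e k)) = y" .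
    have "(\<Oplus>\<^bsub>M\<^esub>s\<in>T. c s \<odot>\<^bsub>M\<^esub> a s) \<in> N" unfolding N_def lincomb_set_def using c(1) TS by auto
    then have "x \<in> N +>\<^bsub>L\<^esub> y"
      unfolding a_r_coset_def' using split[OF c(1)] c(2) by (auto simp: y_def L_def)
    moreover have "y \<in> carrier L"
      unfolding y_def L_def using c(1) lincomb_set_base[OF S a] submoduleE(4)[OF subS]
      by (auto intro!: submodule_finsum_closed[OF subS] simp: Pi_iff)
    ultimately have "U = N +>\<^bsub>L\<^esub> y" using NL.a_repr_independence' x(2) by metis
    then show ?thesis using c' cls[of c'] y' by (intro exI[of _ c']) auto
  qed
  have uniq: "c = c'" if c: "c \<in> {..<?d} \<rightarrow>\<^sub>E carrier R" and c': "c' \<in> {..<?d} \<rightarrow>\<^sub>E carrier R"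
    and eq: "(\<Oplus>\<^bsub>q\<^esub>k\<in>{..<?d}. c k \<odot>\<^bsub>q\<^esub> b k) = (\<Oplus>\<^bsub>q\<^esub>k\<in>{..<?d}. c' k \<odot>\<^bsub>q\<^esub> b k)" for c c'
  proof -
    let ?s = "\<lambda>c. (\<Oplus>\<^bsub>M\<^esub>k\<in>{..<?d}. c k \<odot>\<^bsub>M\<^esub> a (e k))"
    have cP: "c \<in> {..<?d} \<rightarrow> carrier R" "c' \<in> {..<?d} \<rightarrow> carrier R" using c c' by auto
    have in_L: "?s c \<in> carrier L" if "c \<in> {..<?d} \<rightarrow> carrier R" for c
      unfolding L_def using that lincomb_set_base[OF S a] submoduleE(4)[OF subS] eS
      by (auto intro!: submodule_finsum_closed[OF subS] simp: Pi_iff)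
    have "N +>\<^bsub>L\<^esub> ?s c = N +>\<^bsub>L\<^esub> ?s c'" using eq cls[OF cP(1)] cls[OF cP(2)] by simp
    then have "?s c \<in> N +>\<^bsub>L\<^esub> ?s c'" using NL.a_rcos_self[OF in_L[OF cP(1)]] by simp
    then obtain h where h: "h \<in> N" "?s c = h \<oplus>\<^bsub>M\<^esub> ?s c'"
      unfolding a_r_coset_def' by (auto simp: L_def)
    from h(1) obtain g where g: "g \<in> T \<rightarrow> carrier R" "h = (\<Oplus>\<^bsub>M\<^esub>s\<in>T. g s \<odot>\<^bsub>M\<^esub> a s)"
      by (auto simp: N_def lincomb_set_def)
    define e' where "e' = the_inv_into {..<?d} e"
    have e'e: "e' (e k) = k" if "k < ?d" for k
      unfolding e'_def using e that by (auto simp: bij_betw_def intro!: the_inv_into_f_f)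
    have e'd: "e' s < ?d" if "s \<in> S - T" for s
      using the_inv_into_into[of e "{..<?d}" s "{..<?d}"] e that by (auto simp: e'_def bij_betw_def)
    \<comment> \<open>The coefficients of the lifted relation, which expresses \<open>h\<close> plus the difference of the two combinations.\<close>
    define f where "f s = (if s \<in> T then g s else c' (e' s) \<oplus> \<ominus> c (e' s))" for s
    have f: "f \<in> S \<rightarrow> carrier R" using g(1) cP e'd by (auto simp: f_def Pi_iff)
    have sM: "?s c \<in> carrier M" if "c \<in> {..<?d} \<rightarrow> carrier R" for c
      using that a eS by (intro M.finsum_closed) (auto simp: Pi_iff)
    have hM: "h \<in> carrier M" using h(1) submoduleE(1)[OF subT] by auto
    have mc: "(\<lambda>k. \<ominus> c k) \<in> {..<?d} \<rightarrow> carrier R" using cP by auto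
    have neg: "?s (\<lambda>k. \<ominus> c k) = \<ominus>\<^bsub>M\<^esub> ?s c"
    proof -
      have "?s (\<lambda>k. \<ominus> c k) = ?s (\<lambda>k. (\<ominus> \<one>) \<otimes> c k)"
        using cP a eS by (intro M.finsum_cong') (auto simp: Pi_iff R.l_minus)
      also have "\<dots> = (\<ominus> \<one>) \<odot>\<^bsub>M\<^esub> ?s c"
        using cP a eS by (intro lincomb_smult) auto
      also have "\<dots> = \<ominus>\<^bsub>M\<^esub> ?s c" using sM[OF cP(1)] by (simp add: smult_l_minus)
      finally show ?thesis .
    qed
    have "(\<Oplus>\<^bsub>M\<^esub>s\<in>S-T. f s \<odot>\<^bsub>M\<^esub> a s) = ?s (\<lambda>k. f (e k))" using f by (intro reindex) auto
    also have "\<dots> = ?s (\<lambda>k. c' k \<oplus> \<ominus> c k)"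
      using cP a eS by (intro M.finsum_cong') (auto simp: Pi_iff f_def e'e)
    also have "\<dots> = ?s c' \<oplus>\<^bsub>M\<^esub> ?s (\<lambda>k. \<ominus> c k)"
      using cP mc a eS by (intro lincomb_add) auto
    finally have 1: "(\<Oplus>\<^bsub>M\<^esub>s\<in>S-T. f s \<odot>\<^bsub>M\<^esub> a s) = ?s c' \<oplus>\<^bsub>M\<^esub> \<ominus>\<^bsub>M\<^esub> ?s c" using neg by simp
    have 2: "(\<Oplus>\<^bsub>M\<^esub>s\<in>T. f s \<odot>\<^bsub>M\<^esub> a s) = h"
      unfolding g(2) using g(1) T by (intro M.finsum_cong') (auto simp: f_def Pi_iff)
    have "(\<Oplus>\<^bsub>M\<^esub>s\<in>S. f s \<odot>\<^bsub>M\<^esub> a s) = h \<oplus>\<^bsub>M\<^esub> (?s c' \<oplus>\<^bsub>M\<^esub> \<ominus>\<^bsub>M\<^esub> ?s c)"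
      using split[OF f] 1 2 by simp
    also have "\<dots> = (h \<oplus>\<^bsub>M\<^esub> ?s c') \<oplus>\<^bsub>M\<^esub> \<ominus>\<^bsub>M\<^esub> ?s c"
      using hM sM[OF cP(1)] sM[OF cP(2)] by (simp add: M.a_assoc)
    also have "\<dots> = \<zero>\<^bsub>M\<^esub>" using h(2)[symmetric] sM[OF cP(1)] by (simp add: M.r_neg)
    finally have 0: "\<forall>s\<in>S. f s = \<zero>" using indep f by simp
    show "c = c'"
    proof
      fix k
      show "c k = c' k"
      proof (cases "k < ?d")
        case True
        then have "c' k \<oplus> \<ominus> c k = \<zero>" using 0 eS[OF True] e'e[OF True] by (force simp: f_def)
        moreover have "c k \<in> carrier R" "c' k \<in> carrier R" using cP True by auto
        ultimately show ?thesis by (metis R.add.inv_closed R.minus_equality R.minus_minus)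
      next
        case False
        then show ?thesis using c c' by (auto simp: PiE_def extensional_def)
      qed
    qed
  qed
  have "free_of_rank R q ?d"
    unfolding free_of_rank_def
  proof (intro conjI exI[of _ b] ballI ex_ex1I)
    fix U assume "U \<in> carrier q"
    then show "\<exists>c. c \<in> {..<?d} \<rightarrow>\<^sub>E carrier R \<and> U = (\<Oplus>\<^bsub>q\<^esub>k\<in>{..<?d}. c k \<odot>\<^bsub>q\<^esub> b k)" by (rule ex)
  qed (use q.module_axioms bq uniq in auto)
  then show ?thesis by (simp add: q_def L_def N_def)
qed

end


section \<open>Group algebras and invariants under simple transpositions\<close>

lemma group_algebra_simps [simp]:
  "carrier (group_algebra R G) = carrier G \<rightarrow>\<^sub>E carrier R"
  "p \<oplus>\<^bsub>group_algebra R G\<^esub> q = (\<lambda>x\<in>carrier G. p x \<oplus>\<^bsub>R\<^esub> q x)"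
  "\<zero>\<^bsub>group_algebra R G\<^esub> = (\<lambda>x\<in>carrier G. \<zero>\<^bsub>R\<^esub>)"
  "r \<odot>\<^bsub>group_algebra R G\<^esub> p = (\<lambda>x\<in>carrier G. r \<otimes>\<^bsub>R\<^esub> p x)"
  by (simp_all add: group_algebra_def)

context cring
begin

lemma group_algebra_is_module: "module R (group_algebra R G)"
proof (rule moduleI)
  let ?A = "group_algebra R G"
  show "cring R" by (rule cring_axioms)
  show "abelian_group ?A"
  proof (rule abelian_groupI)
    show "\<exists>q\<in>carrier ?A. q \<oplus>\<^bsub>?A\<^esub> p = \<zero>\<^bsub>?A\<^esub>" if "p \<in> carrier ?A" for p
      using that by (intro bexI[where x = "\<lambda>x\<in>carrier G. \<ominus> p x"]) (auto simp: l_neg PiE_iff intro!: restrict_ext)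
  qed (auto simp: PiE_iff a_ac extensional_def fun_eq_iff)
qed (auto simp: PiE_iff l_distr r_distr m_assoc extensional_def fun_eq_iff)

lemma group_algebra_finsum:
  assumes "finite S" "f \<in> S \<rightarrow> carrier (group_algebra R G)" "x \<in> carrier G"
  shows "(\<Oplus>\<^bsub>group_algebra R G\<^esub>s\<in>S. f s) x = (\<Oplus>s\<in>S. f s x)"
proof -
  interpret A: module R "group_algebra R G" by (rule group_algebra_is_module)
  show ?thesis using assms(1,2)
  proof (induction S rule: finite_induct)
    case empty
    then show ?case using assms(3) by (simp only: A.M.finsum_empty finsum_empty) simp
  next
    case (insert s S)
    have "(\<lambda>t. f t x) \<in> insert s S \<rightarrow> carrier R" using insert.prems assms(3) by (auto simp: Pi_iff)
    then show ?case using insert assms(3) A.M.finsum_insert[of S s f] finsum_insert[of S s "\<lambda>t. f t x"]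
      by (simp add: Pi_iff)
  qed
qed

text \<open>
  Right multiplication by \<open>g\<close> translates the coefficients, so that being fixed by a simple
  transposition becomes a symmetry of the coefficient function.
\<close>

lemma group_algebra_mult_ga_of:
  assumes G: "group G" and fin: "finite (carrier G)"
    and q: "q \<in> carrier (group_algebra R G)" and g: "g \<in> carrier G" and x: "x \<in> carrier G"
  shows "(q \<otimes>\<^bsub>group_algebra R G\<^esub> ga_of R G g) x = q (x \<otimes>\<^bsub>G\<^esub> inv\<^bsub>G\<^esub> g)"
proof -
  interpret G: group G by fact
  have iff: "inv\<^bsub>G\<^esub> y \<otimes>\<^bsub>G\<^esub> x = g \<longleftrightarrow> x \<otimes>\<^bsub>G\<^esub> inv\<^bsub>G\<^esub> g = y" if "y \<in> carrier G" for y
    using that g x by (metis G.inv_closed G.inv_solve_left G.inv_solve_right G.m_closed)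
  have "(q \<otimes>\<^bsub>group_algebra R G\<^esub> ga_of R G g) x
      = (\<Oplus>y\<in>carrier G. q y \<otimes> (if inv\<^bsub>G\<^esub> y \<otimes>\<^bsub>G\<^esub> x = g then \<one> else \<zero>))"
    using x q by (auto simp: group_algebra_def ga_of_def PiE_iff intro!: finsum_cong')
  also have "\<dots> = (\<Oplus>y\<in>carrier G. if x \<otimes>\<^bsub>G\<^esub> inv\<^bsub>G\<^esub> g = y then q y else \<zero>)"
    using q by (intro finsum_cong') (auto simp: iff PiE_iff)
  also have "\<dots> = q (x \<otimes>\<^bsub>G\<^esub> inv\<^bsub>G\<^esub> g)"
    using q g x fin by (intro finsum_singleton) auto
  finally show ?thesis .
qed

end

lemma finite_sym_group: "finite (carrier (sym_group n))"
  by (simp add: sym_group_def finite_permutations)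

lemma transpose_in_sym_group:
  assumes "i \<in> {1..n-1}"
  shows "transpose i (i + 1) \<in> carrier (sym_group n)"
  using assms by (auto simp: sym_group_carrier intro!: permutes_swap_id)

lemma sym_group_inv_transpose:
  assumes "i \<in> {1..n-1}"
  shows "inv\<^bsub>sym_group n\<^esub> (transpose i (i + 1)) = transpose i (i + 1)"
  using transpose_in_sym_group[OF assms] sym_group_is_group[of n]
  by (intro group.inv_equality) (auto simp: sym_group_mult sym_group_one)

lemma comp_transpose_in_sym_group:
  assumes "i \<in> {1..n-1}" "x \<in> carrier (sym_group n)"
  shows "x \<circ> transpose i (i + 1) \<in> carrier (sym_group n)"
  using transpose_in_sym_group[OF assms(1)] assms(2)
  by (auto simp: sym_group_carrier intro: permutes_compose)

definition right_invariants :: "('a, 'm) ring_scheme \<Rightarrow> nat \<Rightarrow> nat set \<Rightarrow> ((nat \<Rightarrow> nat) \<Rightarrow> 'a) set"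
  where "right_invariants R n J = {q \<in> carrier (kS R n).
    \<forall>i\<in>J. \<forall>x\<in>carrier (sym_group n). q (x \<circ> transpose i (i + 1)) = q x}"

text \<open>A simple transposition is its own inverse, which removes the inverse from the translation.\<close>

lemma (in cring) F_set_eq_right_invariants: "F_set R n I = right_invariants R n (nonshadow n I)"
proof -
  let ?G = "sym_group n" and ?A = "kS R n"
  have "q \<otimes>\<^bsub>?A\<^esub> ga_of R ?G (transpose i (i + 1)) = q
      \<longleftrightarrow> (\<forall>x\<in>carrier ?G. q (x \<circ> transpose i (i + 1)) = q x)"
    if q: "q \<in> carrier ?A" and i: "i \<in> nonshadow n I" for q i
  proof -
    have i': "i \<in> {1..n-1}" using i by (auto simp: nonshadow_def)
    have eval: "(q \<otimes>\<^bsub>?A\<^esub> ga_of R ?G (transpose i (i + 1))) x = q (x \<circ> transpose i (i + 1))"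
      if "x \<in> carrier ?G" for x
      using group_algebra_mult_ga_of[OF sym_group_is_group finite_sym_group q transpose_in_sym_group[OF i'] that]
        sym_group_inv_transpose[OF i'] by (simp add: sym_group_mult)
    have "q \<otimes>\<^bsub>?A\<^esub> ga_of R ?G (transpose i (i + 1)) \<in> extensional (carrier ?G)"
      by (simp add: group_algebra_def)
    moreover have "q \<in> extensional (carrier ?G)" using q by (simp add: PiE_iff)
    ultimately show ?thesis using eval by (metis extensionalityI)
  qed
  then show ?thesis by (auto simp: F_set_def right_invariants_def)
qed

lemma (in cring) right_invariants_submodule:
  assumes J: "J \<subseteq> {1..n-1}"
  shows "submodule (right_invariants R n J) R (kS R n)"
proof -
  interpret A: module R "kS R n" by (rule group_algebra_is_module)
  have m: "x \<circ> transpose i (i + 1) \<in> carrier (sym_group n)"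
    if "i \<in> J" "x \<in> carrier (sym_group n)" for i x
    using comp_transpose_in_sym_group J that by blast
  have sm: "r \<odot>\<^bsub>kS R n\<^esub> q \<in> right_invariants R n J" if "r \<in> carrier R" "q \<in> right_invariants R n J" for r q
    using that m by (auto simp: right_invariants_def PiE_iff)
  show ?thesis
  proof (rule A.submoduleI)
    show sub: "right_invariants R n J \<subseteq> carrier (kS R n)" by (auto simp: right_invariants_def)
    show "\<zero>\<^bsub>kS R n\<^esub> \<in> right_invariants R n J" using m by (auto simp: right_invariants_def)
    show "p \<oplus>\<^bsub>kS R n\<^esub> q \<in> right_invariants R n J" if "p \<in> right_invariants R n J" "q \<in> right_invariants R n J" for p q
      using that m by (auto simp: right_invariants_def PiE_iff)
    show "\<ominus>\<^bsub>kS R n\<^esub> q \<in> right_invariants R n J" if "q \<in> right_invariants R n J" for q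
    proof -
      have "\<ominus>\<^bsub>kS R n\<^esub> q = (\<ominus> \<one>) \<odot>\<^bsub>kS R n\<^esub> q"
        using A.smult_l_minus[of \<one> q] A.smult_one[of q] sub that by auto
      then show ?thesis using sm[of "\<ominus> \<one>" q] that by simp
    qed
  qed (rule sm)
qed

section \<open>A unitriangular basis adapted to the filtration\<close>

text \<open>
  The coset of \<open>w\<close> modulo the parabolic subgroup generated by the \<open>s\<^sub>j\<close> with \<open>j \<in> Des w\<close>, described
  without that subgroup: its elements map each initial segment ending at a non-descent of \<open>w\<close> to the
  same set as \<open>w\<close> does.
\<close>

definition same_blocks :: "nat \<Rightarrow> (nat \<Rightarrow> nat) \<Rightarrow> (nat \<Rightarrow> nat) \<Rightarrow> bool"
  where "same_blocks n w x \<longleftrightarrow> (\<forall>k\<in>{1..n} - Des n w. x ` {1..k} = w ` {1..k})"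

definition coset_sum :: "('a, 'm) ring_scheme \<Rightarrow> nat \<Rightarrow> (nat \<Rightarrow> nat) \<Rightarrow> (nat \<Rightarrow> nat) \<Rightarrow> 'a"
  where "coset_sum R n w = (\<lambda>x\<in>carrier (sym_group n). if same_blocks n w x then \<one>\<^bsub>R\<^esub> else \<zero>\<^bsub>R\<^esub>)"

text \<open>
  This statistic plays the role of the length of a permutation with the order reversed: it drops
  whenever an ascent is turned into a descent.
\<close>

definition weight :: "nat \<Rightarrow> (nat \<Rightarrow> nat) \<Rightarrow> nat"
  where "weight n x = (\<Sum>k\<in>{1..n}. k * x k)"

lemma transpose_image_initial_segment:
  assumes "1 \<le> i" "k \<noteq> i"
  shows "transpose i (i + 1) ` {1..k} = {1..k::nat}"
proof (cases "k < i")
  case True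
  then have "transpose i (i + 1) ` {1..k} = id ` {1..k}" by (intro image_cong) (auto simp: transpose_def)
  then show ?thesis by simp
next
  case False
  then show ?thesis using assms by (intro permutes_image permutes_swap_id) auto
qed

lemma same_blocks_comp_transpose:
  assumes "i \<in> Des n w"
  shows "same_blocks n w (x \<circ> transpose i (i + 1)) \<longleftrightarrow> same_blocks n w x"
proof -
  have "(x \<circ> transpose i (i + 1)) ` {1..k} = x ` {1..k}" if "k \<in> {1..n} - Des n w" for k
  proof -
    have "1 \<le> i" "k \<noteq> i" using assms that by (auto simp: Des_def)
    then show ?thesis unfolding image_comp[symmetric] by (subst transpose_image_initial_segment) auto
  qed
  then show ?thesis by (simp add: same_blocks_def)
qed

lemma weight_comp_transpose_less:
  assumes i: "i \<in> {1..n-1}" and less: "x i < x (i + 1)"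
  shows "weight n (x \<circ> transpose i (i + 1)) < weight n x"
proof -
  define S where "S = {1..n} - {i, i + 1}"
  have S: "{1..n} = insert i (insert (i + 1) S)" "finite S" "i \<notin> S" "i + 1 \<notin> S"
    using i by (auto simp: S_def)
  have "weight n y = i * y i + ((i + 1) * y (i + 1) + (\<Sum>k\<in>S. k * y k))" for y
    unfolding weight_def S(1) using S(2-4) by simp
  moreover have "(\<Sum>k\<in>S. k * (x \<circ> transpose i (i + 1)) k) = (\<Sum>k\<in>S. k * x k)"
    using S by (intro sum.cong) (auto simp: transpose_def)
  ultimately show ?thesis using less by (simp add: algebra_simps)
qed

lemma not_descent_less:
  assumes "x \<in> carrier (sym_group n)" "i \<in> {1..n-1}" "i \<notin> Des n x"
  shows "x i < x (i + 1)"
proof -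
  have "inj x" using assms(1) by (simp add: sym_group_carrier permutes_inj)
  then have "x i \<noteq> x (i + 1)" by (simp add: inj_eq)
  then show ?thesis using assms(2,3) by (auto simp: Des_def)
qed

text \<open>
  Unitriangularity. As long as some descent of \<open>w\<close> is an ascent of \<open>x\<close>, swapping there stays within
  the coset and lowers the weight; the descent can only end at an element which has all descents of
  \<open>w\<close>, and \<open>w\<close> is the only such element of its coset.
\<close>

lemma same_blocks_weight:
  assumes w: "w \<in> carrier (sym_group n)" and x: "x \<in> carrier (sym_group n)" and "same_blocks n w x"
  shows "x = w \<or> weight n w < weight n x"
  using x assms(3)
proof (induction "weight n x" arbitrary: x rule: less_induct)
  case less
  show ?case
  proof (cases "Des n w \<subseteq> Des n x")
    case True
    have perm: "x permutes {1..n}" "w permutes {1..n}"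
      using less.prems(1) w by (simp_all add: sym_group_carrier)
    have "x j = w j" if "j \<in> {1..<n+1}" for j
    proof (rule eq_if_common_descents[where x = x and y = w and a = 1 and b = "n + 1" and J = "Des n w"])
      show "inj_on x {1..<n+1}" "inj_on w {1..<n+1}"
        using perm by (auto intro: inj_on_subset[OF permutes_inj])
      show "x ` {1..k} = w ` {1..k}" if "1 \<le> k" "k < n + 1" "k \<notin> Des n w" for k
        using less.prems(2) that by (auto simp: same_blocks_def)
      show "j + 1 < n + 1" "w (j + 1) < w j" if "j \<in> Des n w" for j
        using that unfolding Des_def by (simp_all, linarith)
      show "x (j + 1) < x j" if "j \<in> Des n w" for j
        using that True unfolding Des_def by blast
    qed (rule that)
    moreover have "x j = w j" if "j \<notin> {1..<n+1}" for j
    proof -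
      have "j \<notin> {1..n}" using that by auto
      then show ?thesis using perm by (simp add: permutes_not_in)
    qed
    ultimately have "x = w" by blast
    then show ?thesis by simp
  next
    case False
    then obtain i where i: "i \<in> Des n w" "i \<notin> Des n x" by auto
    then have i': "i \<in> {1..n-1}" by (auto simp: Des_def)
    let ?y = "x \<circ> transpose i (i + 1)"
    have wt: "weight n ?y < weight n x"
      using weight_comp_transpose_less[OF i'] not_descent_less[OF less.prems(1) i' i(2)] by blast
    have "?y = w \<or> weight n w < weight n ?y"
      using less.hyps[OF wt comp_transpose_in_sym_group[OF i' less.prems(1)]]
        same_blocks_comp_transpose[OF i(1)] less.prems(2) by blast
    then show ?thesis using wt by auto
  qed
qed

lemma same_blocks_refl: "same_blocks n w w"
  by (simp add: same_blocks_def)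

context cring
begin

lemma coset_sum_closed: "coset_sum R n w \<in> carrier (kS R n)"
  by (auto simp: coset_sum_def)

lemma coset_sum_right_invariant:
  assumes "J \<subseteq> Des n w"
  shows "coset_sum R n w \<in> right_invariants R n J"
proof -
  have "coset_sum R n w (x \<circ> transpose i (i + 1)) = coset_sum R n w x"
    if "i \<in> J" and x: "x \<in> carrier (sym_group n)" for i x
  proof -
    have i: "i \<in> Des n w" using that(1) assms by auto
    then have "x \<circ> transpose i (i + 1) \<in> carrier (sym_group n)"
      using comp_transpose_in_sym_group[OF _ x] by (auto simp: Des_def)
    then show ?thesis using x same_blocks_comp_transpose[OF i] by (simp add: coset_sum_def)
  qed
  then show ?thesis using coset_sum_closed by (simp add: right_invariants_def del: group_algebra_simps)
qed

text \<open>
  Gaussian elimination along the weight. The support is confined to a set \<open>U\<close> which contains, with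
  any of its elements, all permutations of larger weight; an element \<open>x\<close> of least weight is removed
  from \<open>U\<close> by subtracting a multiple of \<open>a\<^sub>x\<close>. The set \<open>U\<close>, instead of the support itself, serves as
  the induction parameter because the subtraction may enlarge the support at larger weights.
\<close>

lemma right_invariants_support_lincomb:
  assumes J: "J \<subseteq> {1..n-1}" and U: "U \<subseteq> carrier (sym_group n)"
    and up: "\<And>x y. \<lbrakk>x \<in> U; y \<in> carrier (sym_group n); weight n x < weight n y\<rbrakk> \<Longrightarrow> y \<in> U"
    and q: "q \<in> right_invariants R n J" and supp: "\<And>x. \<lbrakk>x \<in> carrier (sym_group n); x \<notin> U\<rbrakk> \<Longrightarrow> q x = \<zero>"
  shows "q \<in> lincomb_set R (kS R n) (coset_sum R n) {w \<in> carrier (sym_group n). J \<subseteq> Des n w}"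
proof -
  interpret A: module R "kS R n" by (rule group_algebra_is_module)
  let ?G = "carrier (sym_group n)"
  let ?S = "{w \<in> ?G. J \<subseteq> Des n w}"
  let ?L = "lincomb_set R (kS R n) (coset_sum R n) ?S"
  have S: "finite ?S" "coset_sum R n \<in> ?S \<rightarrow> carrier (kS R n)"
    using finite_sym_group coset_sum_closed by (auto simp del: group_algebra_simps)
  note L = A.submoduleE[OF A.lincomb_set_submodule[OF S]]
  note I = A.submoduleE[OF right_invariants_submodule[OF J]]
  have finU: "finite U" using U finite_sym_group finite_subset by blast
  show ?thesis using finU U up q supp
  proof (induction U arbitrary: q rule: finite_psubset_induct)
    case (psubset U)
    have qA: "q \<in> carrier (kS R n)" using psubset.prems(3) by (simp add: right_invariants_def)
    show ?case
    proof (cases "U = {}")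
      case True
      then have "q = \<zero>\<^bsub>kS R n\<^esub>" using psubset.prems(4) qA
        by (auto simp: PiE_iff extensional_def fun_eq_iff)
      moreover have "\<zero>\<^bsub>kS R n\<^esub> \<in> ?L"
        using submodule.axioms(1)[OF A.lincomb_set_submodule[OF S]] subgroup.one_closed by fastforce
      ultimately show ?thesis by (simp only:)
    next
      case False
      define x where "x = arg_min_on (weight n) U"
      have x: "x \<in> U" "\<And>y. y \<in> U \<Longrightarrow> weight n x \<le> weight n y"
        using arg_min_if_finite[OF psubset.hyps False, of "weight n"]
        by (auto simp: x_def not_less)
      have xG: "x \<in> ?G" using x(1) psubset.prems(1) by auto
      have qx: "q x \<in> carrier R" using qA xG by auto
      have up': "y \<in> U - {x}" if "z \<in> U - {x}" "y \<in> ?G" "weight n z < weight n y" for y z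
        using psubset.prems(2)[of z y] x(2)[of z] that by auto
      have sub: "U - {x} \<subset> U" "U - {x} \<subseteq> ?G" using x(1) psubset.prems(1) by auto
      have IH: "p \<in> ?L" if "p \<in> right_invariants R n J"
        "\<And>y. \<lbrakk>y \<in> ?G; y \<notin> U - {x}\<rbrakk> \<Longrightarrow> p y = \<zero>" for p
        by (rule psubset.IH[OF sub _ that]) (rule up', assumption+)
      show ?thesis
      proof (cases "q x = \<zero>")
        case True
        then have "q y = \<zero>" if "y \<in> ?G" "y \<notin> U - {x}" for y
          using psubset.prems(4)[of y] that by auto
        then show ?thesis using IH[OF psubset.prems(3)] by blast
      next
        case nz: False
        \<comment> \<open>At an ascent \<open>i \<in> J\<close> of \<open>x\<close>, the lighter permutation \<open>x s\<^sub>i\<close> would lie in the support too.\<close>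
        have JD: "J \<subseteq> Des n x"
        proof
          fix i assume i: "i \<in> J"
          then have i': "i \<in> {1..n-1}" using J by auto
          let ?y = "x \<circ> transpose i (i + 1)"
          have yG: "?y \<in> ?G" using comp_transpose_in_sym_group[OF i' xG] .
          have "q ?y = q x" using psubset.prems(3) i xG by (simp add: right_invariants_def)
          then have "?y \<in> U" using nz psubset.prems(4)[OF yG] by metis
          then have "\<not> weight n ?y < weight n x" using x(2) by (simp add: not_less)
          then show "i \<in> Des n x"
            using weight_comp_transpose_less[OF i'] not_descent_less[OF xG i'] by blast
        qed
        let ?m = "(\<ominus> q x) \<odot>\<^bsub>kS R n\<^esub> coset_sum R n x"
        define q' where "q' = q \<oplus>\<^bsub>kS R n\<^esub> ?m"
        have "q' \<in> right_invariants R n J"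
          unfolding q'_def using I(4,5) psubset.prems(3) coset_sum_right_invariant[OF JD] qx
          by (simp del: group_algebra_simps)
        moreover have "q' y = \<zero>" if y: "y \<in> ?G" "y \<notin> U - {x}" for y
        proof (cases "y = x")
          case True
          then show ?thesis using xG qx
            by (simp add: q'_def coset_sum_def same_blocks_refl r_neg)
        next
          case False
          then have "y \<notin> U" using y(2) by simp
          then have "\<not> same_blocks n x y"
            using same_blocks_weight[OF xG y(1)] False psubset.prems(2)[OF x(1) y(1)] by blast
          then show ?thesis using y(1) \<open>y \<notin> U\<close> psubset.prems(4) qx
            by (simp add: q'_def coset_sum_def)
        qed
        ultimately have "q' \<in> ?L" using IH by blast
        moreover have "coset_sum R n x \<in> ?L" using A.lincomb_set_base[OF S] xG JD by blast
        ultimately have "q' \<oplus>\<^bsub>kS R n\<^esub> (q x \<odot>\<^bsub>kS R n\<^esub> coset_sum R n x) \<in> ?L"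
          using L(4,5) qx by (simp del: group_algebra_simps)
        moreover have "q' \<oplus>\<^bsub>kS R n\<^esub> (q x \<odot>\<^bsub>kS R n\<^esub> coset_sum R n x) = q"
        proof (rule extensionalityI)
          fix y assume y: "y \<in> ?G"
          have "q y \<in> carrier R" "coset_sum R n x y \<in> carrier R"
            using qA coset_sum_closed[of n x] y by auto
          then show "(q' \<oplus>\<^bsub>kS R n\<^esub> (q x \<odot>\<^bsub>kS R n\<^esub> coset_sum R n x)) y = q y"
            using y qx by (simp add: q'_def a_assoc l_minus l_neg)
        qed (use qA in \<open>auto simp: PiE_iff\<close>)
        ultimately show ?thesis by simp
      qed
    qed
  qed
qed

lemma right_invariants_eq_lincomb_set:
  assumes J: "J \<subseteq> {1..n-1}"
  shows "right_invariants R n J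
    = lincomb_set R (kS R n) (coset_sum R n) {w \<in> carrier (sym_group n). J \<subseteq> Des n w}"
proof
  interpret A: module R "kS R n" by (rule group_algebra_is_module)
  show "lincomb_set R (kS R n) (coset_sum R n) {w \<in> carrier (sym_group n). J \<subseteq> Des n w}
      \<subseteq> right_invariants R n J"
    using coset_sum_right_invariant by (intro A.lincomb_set_least[OF right_invariants_submodule[OF J]]) auto
  show "right_invariants R n J
      \<subseteq> lincomb_set R (kS R n) (coset_sum R n) {w \<in> carrier (sym_group n). J \<subseteq> Des n w}"
    using right_invariants_support_lincomb[OF J order_refl] by blast
qed

text \<open>
  In a relation, consider the coefficient at a permutation \<open>w\<close> of least weight among those with
  \<open>c w \<noteq> 0\<close>: the other \<open>a\<^sub>v\<close> containing \<open>w\<close> have smaller weight \<open>v\<close>, hence do not occur.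
\<close>

lemma coset_sum_independent:
  assumes S: "S \<subseteq> carrier (sym_group n)" and c: "c \<in> S \<rightarrow> carrier R"
    and zero: "(\<Oplus>\<^bsub>kS R n\<^esub>w\<in>S. c w \<odot>\<^bsub>kS R n\<^esub> coset_sum R n w) = \<zero>\<^bsub>kS R n\<^esub>"
  shows "\<forall>w\<in>S. c w = \<zero>"
proof (rule ccontr)
  interpret A: module R "kS R n" by (rule group_algebra_is_module)
  assume "\<not> (\<forall>w\<in>S. c w = \<zero>)"
  then have ne: "{w \<in> S. c w \<noteq> \<zero>} \<noteq> {}" by auto
  have fS: "finite S" using S finite_sym_group finite_subset by blast
  define w where "w = arg_min_on (weight n) {w \<in> S. c w \<noteq> \<zero>}"
  have w: "w \<in> S" "c w \<noteq> \<zero>" "\<And>v. \<lbrakk>v \<in> S; c v \<noteq> \<zero>\<rbrakk> \<Longrightarrow> weight n w \<le> weight n v"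
    using arg_min_if_finite[OF _ ne, of "weight n"] fS by (auto simp: w_def not_less)
  have wG: "w \<in> carrier (sym_group n)" using w(1) S by auto
  have clos: "(\<lambda>v. c v \<odot>\<^bsub>kS R n\<^esub> coset_sum R n v) \<in> S \<rightarrow> carrier (kS R n)"
    using c coset_sum_closed by (intro A.lincomb_closed) (auto simp del: group_algebra_simps)
  have "\<zero> = (\<Oplus>v\<in>S. (c v \<odot>\<^bsub>kS R n\<^esub> coset_sum R n v) w)"
    using group_algebra_finsum[OF fS clos wG] zero wG by simp
  also have "\<dots> = (\<Oplus>v\<in>S. if w = v then c v else \<zero>)"
  proof (intro finsum_cong')
    fix v assume v: "v \<in> S"
    then have vG: "v \<in> carrier (sym_group n)" and cv: "c v \<in> carrier R" using S c by auto
    show "(c v \<odot>\<^bsub>kS R n\<^esub> coset_sum R n v) w = (if w = v then c v else \<zero>)"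
    proof (cases "same_blocks n v w")
      case True
      then have "w = v \<or> weight n v < weight n w" using same_blocks_weight[OF vG wG] by blast
      then show ?thesis
        using w(3)[OF v] cv wG True by (cases "c v = \<zero>") (auto simp: coset_sum_def)
    next
      case False
      then have "w \<noteq> v" using same_blocks_refl by auto
      then show ?thesis using False wG cv by (simp add: coset_sum_def)
    qed
  qed (use c in auto)
  also have "\<dots> = c w" using c w(1) fS by (intro finsum_singleton) auto
  finally show False using w(2) by simp
qed

text \<open>
  The summand \<open>F(Q\<^sub>i)\<close> contributes the \<open>a\<^sub>w\<close> with \<open>Q\<^sub>i' \<subseteq> Des w\<close>. All of these have \<open>Qind w \<le> i\<close>
  because \<open>Qind w\<close> is the least such index, and all \<open>w\<close> with \<open>Qind w = i\<close> are among them.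
\<close>

lemma F_filt_eq_lincomb_set:
  assumes Q: "lacunar_listing n Q" and i: "i \<le> fib (n + 1)"
  shows "F_filt R n Q i
    = lincomb_set R (kS R n) (coset_sum R n) {w \<in> carrier (sym_group n). Qind n Q w \<le> i}"
  using i
proof (induction i)
  interpret A: module R "kS R n" by (rule group_algebra_is_module)
  let ?G = "carrier (sym_group n)"
  have Qind: "Qind n Q w \<in> {1..fib (n + 1)}" for w
    using Qind_unique[OF Q, of w] by metis
  {
    case 0
    have "\<not> Qind n Q w \<le> 0" for w using Qind[of w] by simp
    then have empty: "{w \<in> ?G. Qind n Q w \<le> 0} = {}" by blast
    show ?case unfolding empty
      by (simp add: lincomb_set_def A.M.finsum_empty del: group_algebra_simps)
  next
    case (Suc i)
    let ?L = "lincomb_set R (kS R n) (coset_sum R n)"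
    let ?S = "\<lambda>i. {w \<in> ?G. Qind n Q w \<le> i}"
    let ?J = "nonshadow n (Q (Suc i))"
    have iF: "Suc i \<in> {1..fib (n + 1)}" using Suc.prems by auto
    have J: "?J \<subseteq> {1..n-1}" by (auto simp: nonshadow_def)
    have fin: "finite (?S k)" for k using finite_sym_group by simp
    have cl: "coset_sum R n \<in> S \<rightarrow> carrier (kS R n)" for S using coset_sum_closed by auto
    note sub = A.lincomb_set_submodule[OF fin cl]
    have le: "Qind n Q w \<le> Suc i" if "?J \<subseteq> Des n w" for w
      unfolding Qind_def using that iF by (intro Least_le) auto
    have des: "?J \<subseteq> Des n w" if "Qind n Q w = Suc i" for w
      using Qind_unique[OF Q, of w] that iF by metis
    have F: "F_filt R n Q (Suc i) = ?L (?S i) <+>\<^bsub>kS R n\<^esub> right_invariants R n ?J"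
      using Suc by (simp add: F_set_eq_right_invariants del: group_algebra_simps)
    have 1: "?L (?S i) \<subseteq> ?L (?S (Suc i))"
      using A.lincomb_set_base[OF fin cl] by (intro A.lincomb_set_least[OF sub]) auto
    have 2: "right_invariants R n ?J \<subseteq> ?L (?S (Suc i))"
      unfolding right_invariants_eq_lincomb_set[OF J]
      using A.lincomb_set_base[OF fin cl, of _ "Suc i"] le by (intro A.lincomb_set_least[OF sub]) auto
    have "?L (?S i) <+>\<^bsub>kS R n\<^esub> right_invariants R n ?J \<subseteq> ?L (?S (Suc i))"
      unfolding set_add_def' using A.submoduleE(5)[OF sub] 1 2 by blast
    moreover have "?L (?S (Suc i)) \<subseteq> ?L (?S i) <+>\<^bsub>kS R n\<^esub> right_invariants R n ?J"
    proof
      fix q assume "q \<in> ?L (?S (Suc i))"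
      then obtain c where c: "c \<in> ?S (Suc i) \<rightarrow> carrier R"
        "q = (\<Oplus>\<^bsub>kS R n\<^esub>w\<in>?S (Suc i). c w \<odot>\<^bsub>kS R n\<^esub> coset_sum R n w)"
        by (auto simp: lincomb_set_def)
      let ?E = "{w \<in> ?G. Qind n Q w = Suc i}"
      have un: "?S (Suc i) = ?S i \<union> ?E" "?S i \<inter> ?E = {}" by auto
      have clos: "(\<lambda>w. c w \<odot>\<^bsub>kS R n\<^esub> coset_sum R n w) \<in> ?S (Suc i) \<rightarrow> carrier (kS R n)"
        using c(1) cl by (rule A.lincomb_closed)
      have "q = (\<Oplus>\<^bsub>kS R n\<^esub>w\<in>?S i. c w \<odot>\<^bsub>kS R n\<^esub> coset_sum R n w)
          \<oplus>\<^bsub>kS R n\<^esub> (\<Oplus>\<^bsub>kS R n\<^esub>w\<in>?E. c w \<odot>\<^bsub>kS R n\<^esub> coset_sum R n w)"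
        unfolding c(2) un(1) using clos un fin[of i] finite_sym_group
        by (intro A.M.finsum_Un_disjoint) (auto simp del: group_algebra_simps)
      moreover have "(\<Oplus>\<^bsub>kS R n\<^esub>w\<in>?S i. c w \<odot>\<^bsub>kS R n\<^esub> coset_sum R n w) \<in> ?L (?S i)"
        using c(1) unfolding lincomb_set_def by (intro image_eqI[where x = c]) auto
      moreover have "(\<Oplus>\<^bsub>kS R n\<^esub>w\<in>?E. c w \<odot>\<^bsub>kS R n\<^esub> coset_sum R n w) \<in> right_invariants R n ?J"
        using c(1) coset_sum_right_invariant[OF des] A.submoduleE(4)[OF right_invariants_submodule[OF J]]
        by (intro A.submodule_finsum_closed[OF right_invariants_submodule[OF J]]) (auto simp: Pi_iff simp del: group_algebra_simps)
      ultimately show "q \<in> ?L (?S i) <+>\<^bsub>kS R n\<^esub> right_invariants R n ?J"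
        unfolding set_add_def' by blast
    qed
    ultimately show ?case using F by blast
  }
qed

lemma free_of_rank_F_filt_quotient:
  assumes Q: "lacunar_listing n Q" and i: "i \<in> {1..fib (n + 1)}"
  shows "free_of_rank R
       (quotient_module ((kS R n)\<lparr>carrier := F_filt R n Q i\<rparr>) (F_filt R n Q (i - 1)))
       (card {w \<in> carrier (sym_group n). Qind n Q w = i})"
proof -
  interpret A: module R "kS R n" by (rule group_algebra_is_module)
  let ?S = "\<lambda>i. {w \<in> carrier (sym_group n). Qind n Q w \<le> i}"
  have "free_of_rank R (quotient_module ((kS R n)\<lparr>carrier := lincomb_set R (kS R n) (coset_sum R n) (?S i)\<rparr>)
      (lincomb_set R (kS R n) (coset_sum R n) (?S (i - 1)))) (card (?S i - ?S (i - 1)))"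
  proof (rule A.free_of_rank_quotient_lincomb_set)
    show "coset_sum R n \<in> ?S i \<rightarrow> carrier (kS R n)" using coset_sum_closed by auto
    show "\<forall>w\<in>?S i. c w = \<zero>" if "c \<in> ?S i \<rightarrow> carrier R"
      "(\<Oplus>\<^bsub>kS R n\<^esub>w\<in>?S i. c w \<odot>\<^bsub>kS R n\<^esub> coset_sum R n w) = \<zero>\<^bsub>kS R n\<^esub>" for c
      using coset_sum_independent[OF _ that] by blast
  qed (use finite_sym_group in auto)
  moreover have "?S i - ?S (i - 1) = {w \<in> carrier (sym_group n). Qind n Q w = i}"
    using i by auto
  moreover have "F_filt R n Q i = lincomb_set R (kS R n) (coset_sum R n) (?S i)"
    "F_filt R n Q (i - 1) = lincomb_set R (kS R n) (coset_sum R n) (?S (i - 1))"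
    using F_filt_eq_lincomb_set[OF Q] i by auto
  ultimately show ?thesis by simp
qed

end


section \<open>The size of a fibre of the index\<close>

lemma Qind_fibre:
  assumes Q: "lacunar_listing n Q" and i: "i \<in> {1..fib (n + 1)}"
  shows "{w \<in> carrier (sym_group n). Qind n Q w = i}
    = {w \<in> carrier (sym_group n).
        (\<forall>j\<in>Q i. w j < w (j + 1)) \<and> (\<forall>j\<in>nonshadow n (Q i). w j > w (j + 1))}"
proof -
  have Qi: "Q i \<subseteq> {1..n-1}"
    using Q i bij_betwE by (fastforce simp: lacunar_listing_def)
  have "Qind n Q w = i \<longleftrightarrow> (\<forall>j\<in>Q i. w j < w (j + 1)) \<and> (\<forall>j\<in>nonshadow n (Q i). w j > w (j + 1))"
    if w: "w \<in> carrier (sym_group n)" for w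
  proof -
    have "Qind n Q w = i \<longleftrightarrow> Q i \<inter> Des n w = {} \<and> nonshadow n (Q i) \<subseteq> Des n w"
      using Qind_unique[OF Q, of w] i by metis
    also have "Q i \<inter> Des n w = {} \<longleftrightarrow> (\<forall>j\<in>Q i. w j < w (j + 1))"
    proof -
      have "j \<notin> Des n w \<longleftrightarrow> w j < w (j + 1)" if "j \<in> Q i" for j
        using that Qi not_descent_less[OF w, of j] by (auto simp: Des_def)
      then show ?thesis by blast
    qed
    also have "nonshadow n (Q i) \<subseteq> Des n w \<longleftrightarrow> (\<forall>j\<in>nonshadow n (Q i). w j > w (j + 1))"
      by (auto simp: Des_def nonshadow_def)
    finally show ?thesis .
  qed
  then show ?thesis by blast
qed

lemma UN_consecutive_intervals:
  fixes a :: "nat \<Rightarrow> nat"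
  assumes "\<And>k. k \<in> {1..m} \<Longrightarrow> a (k - 1) \<le> a k"
  shows "(\<Union>k\<in>{1..m}. {a (k - 1)..<a k}) = {a 0..<a m} \<and> a 0 \<le> a m"
  using assms
proof (induction m)
  case (Suc m)
  have IH: "(\<Union>k\<in>{1..m}. {a (k - 1)..<a k}) = {a 0..<a m}" "a 0 \<le> a m" using Suc by auto
  have "a m \<le> a (Suc m)" using Suc.prems[of "Suc m"] by simp
  moreover have "{1..Suc m} = insert (Suc m) {1..m}" by auto
  ultimately show ?case using IH by (auto simp: ivl_disj_un)
qed simp

text \<open>
  The blocks are the intervals \<open>[a (k - 1), a k)\<close>. A position \<open>j\<close> of \<open>nonshadow n I\<close> never is the
  last one of its block, since then \<open>j + 1\<close> would be in \<open>I\<close> or equal \<open>n + 1\<close>, and it is the first one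
  only in the block \<open>k = 1\<close>, since all other blocks begin with an element of \<open>I\<close>. Thus all conditions
  compare two positions of one block. Lacunarity makes each block after the first at least two long,
  so that its initial ascent lies inside it; the first block is empty if \<open>1 \<in> I\<close>.
\<close>

lemma card_lacunar_pattern:
  fixes a :: "nat \<Rightarrow> nat"
  assumes mono: "strict_mono_on {1..p} a" and I: "I = a ` {1..p}" "I \<subseteq> {1..n-1}" "lacunar I"
    and a0: "a 0 = 1" and ap: "a (p + 1) = n + 1"
  shows "card {w \<in> carrier (sym_group n).
        (\<forall>j\<in>I. w j < w (j + 1)) \<and> (\<forall>j\<in>nonshadow n I. w j > w (j + 1))}
      * (\<Prod>k=1..p+1. fact (a k - a (k - 1))) = fact n * (\<Prod>k=2..p+1. a k - a (k - 1) - 1)"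
    and "\<forall>k\<in>{2..p+1}. a (k - 1) + 2 \<le> a k"
proof -
  have aI: "a k \<in> I" if "k \<in> {1..p}" for k using that I(1) by auto
  have gap: "a (k - 1) + 2 \<le> a k" if k: "k \<in> {2..p+1}" for k
  proof (cases "k = p + 1")
    case True
    then have "a p \<in> {1..n-1}" using k aI[of p] I(2) by auto
    then show ?thesis using True ap by auto
  next
    case False
    then have k': "k - 1 \<in> {1..p}" "k \<in> {1..p}" "k - 1 < k" using k by auto
    then have "a (k - 1) < a k" using strict_mono_onD[OF mono] by blast
    moreover have "a (k - 1) + 1 \<noteq> a k" using aI[OF k'(1)] aI[OF k'(2)] I(3) by (auto simp: lacunar_def)
    ultimately show ?thesis by simp
  qed
  then show "\<forall>k\<in>{2..p+1}. a (k - 1) + 2 \<le> a k" by blast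
  have step: "a (k - 1) \<le> a k" if k: "k \<in> {1..p+1}" for k
  proof (cases "k = 1")
    case True
    show ?thesis
    proof (cases "p = 0")
      case False
      then have "a 1 \<in> {1..n-1}" using aI[of 1] I(2) by auto
      then show ?thesis using True a0 by simp
    qed (use True a0 ap in simp)
  next
    case False
    then show ?thesis using gap[of k] k by simp
  qed
  have le: "a k \<le> a l" if "k \<le> l" "l \<le> p + 1" for k l
    using that
  proof (induction l rule: dec_induct)
    case (step l)
    then show ?case using \<open>\<And>k. k \<in> {1..p+1} \<Longrightarrow> a (k - 1) \<le> a k\<close>[of "Suc l"] by simp
  qed simp
  let ?K = "{1..p+1}"
  let ?A = "\<lambda>k. {a (k - 1)..<a k}"
  define P where "P k w = (if k = 1 then descending (a (k - 1)) (a k) w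
    else w (a (k - 1)) < w (a (k - 1) + 1) \<and> descending (a (k - 1) + 1) (a k) w)" for k w
  define N where "N k = (if k = 1 then 1 else a k - a (k - 1) - 1)" for k
  have UN: "(\<Union>k\<in>?K. ?A k) = {1..n}"
    using UN_consecutive_intervals[of "p + 1" a] step a0 ap by auto
  have perm: "w \<in> carrier (sym_group n) \<longleftrightarrow> bij_betw w {1..n} {1..n} \<and> (\<forall>x. x \<notin> {1..n} \<longrightarrow> w x = x)" for w
    unfolding sym_group_carrier
    by (metis bij_imp_permutes permutes_imp_bij permutes_not_in)
  have notI: "j \<notin> I" if "k \<in> ?K" "k = 1 \<or> a (k - 1) < j" "j < a k" for j k
  proof
    assume "j \<in> I"
    then obtain l where l: "l \<in> {1..p}" "j = a l" using I(1) by auto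
    show False
    proof (cases "l < k")
      case True
      then have "k \<noteq> 1" "a l \<le> a (k - 1)" using l le[of l "k - 1"] that(1) by auto
      then show False using that(2) l(2) by simp
    next
      case False
      then show False using le[of k l] l that(3) by simp
    qed
  qed
  have ns: "j \<in> nonshadow n I" if k: "k \<in> ?K" "k = 1 \<or> a (k - 1) < j" "1 \<le> j" "j + 1 < a k" for j k
  proof -
    have "a k \<le> n + 1" using le[of k "p + 1"] k(1) ap by simp
    then have "j \<in> {1..n-1}" using k(3,4) by auto
    moreover have "j \<notin> I" "j + 1 \<notin> I" using notI[OF k(1), of j] notI[OF k(1), of "j + 1"] k by auto
    ultimately show ?thesis by (simp add: nonshadow_def)
  qed
  have apos: "1 \<le> a k" if "k \<le> p + 1" for k using le[of 0 k] that a0 by simp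
  have iff: "(\<forall>j\<in>I. w j < w (j + 1)) \<and> (\<forall>j\<in>nonshadow n I. w j > w (j + 1)) \<longleftrightarrow> (\<forall>k\<in>?K. P k w)"
    (is "?L \<longleftrightarrow> ?R") for w :: "nat \<Rightarrow> nat"
  proof
    assume L: ?L
    show ?R
    proof
      fix k assume k: "k \<in> ?K"
      show "P k w"
      proof (cases "k = 1")
        case True
        have "w j > w (j + 1)" if "a 0 \<le> j" "j + 1 < a 1" for j
          using L ns[of 1 j] that a0 by auto
        then show ?thesis using True by (simp add: P_def)
      next
        case False
        then have "a (k - 1) \<in> I" using k by (intro aI) auto
        then have "w (a (k - 1)) < w (a (k - 1) + 1)" using L by blast
        moreover have "w j > w (j + 1)" if "a (k - 1) + 1 \<le> j" "j + 1 < a k" for j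
          using L ns[OF k, of j] that by auto
        ultimately show ?thesis using False by (simp add: P_def)
      qed
    qed
  next
    assume R: ?R
    have "w j < w (j + 1)" if "j \<in> I" for j
    proof -
      obtain l where l: "l \<in> {1..p}" "j = a l" using \<open>j \<in> I\<close> I(1) by auto
      then have "P (l + 1) w" using R by auto
      then show ?thesis using l by (simp add: P_def)
    qed
    moreover have "w j > w (j + 1)" if j: "j \<in> nonshadow n I" for j
    proof -
      have j': "1 \<le> j" "j + 1 \<le> n" "j \<notin> I" "j + 1 \<notin> I" using j by (auto simp: nonshadow_def)
      then have "j \<in> (\<Union>k\<in>?K. ?A k)" unfolding UN by simp
      then obtain k where k: "k \<in> ?K" "a (k - 1) \<le> j" "j < a k" by auto
      have "j + 1 \<noteq> a k" using aI[of k] j'(2,4) ap k(1) by (cases "k = p + 1") auto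
      then have jk: "j + 1 < a k" using k(3) by simp
      have Pk: "P k w" using R k(1) by blast
      show ?thesis
      proof (cases "k = 1")
        case True
        then show ?thesis using Pk k(2) jk by (simp add: P_def)
      next
        case False
        then have "a (k - 1) \<in> I" using k(1) by (intro aI) auto
        then have "a (k - 1) + 1 \<le> j" using j'(3) k(2) by (cases "a (k - 1) = j") auto
        then show ?thesis using Pk False jk by (simp add: P_def)
      qed
    qed
    ultimately show ?L by blast
  qed
  have arr: "{w \<in> carrier (sym_group n). (\<forall>j\<in>I. w j < w (j + 1)) \<and> (\<forall>j\<in>nonshadow n I. w j > w (j + 1))}
      = arrangements (\<Union>k\<in>?K. ?A k) {1..n} (\<lambda>w. \<forall>k\<in>?K. P k w)"
    unfolding UN arrangements_def iff perm by blast
  have "card (arrangements (\<Union>k\<in>?K. ?A k) {1..n} (\<lambda>w. \<forall>k\<in>?K. P k w)) * (\<Prod>k\<in>?K. fact (card (?A k)))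
      = fact (card {1..n}) * (\<Prod>k\<in>?K. N k)"
  proof (rule card_arrangements_UN)
    show disj: "?A k \<inter> ?A l = {}" if "k \<in> ?K" "l \<in> ?K" "k \<noteq> l" for k l
    proof (cases "k < l")
      case True
      then have "a k \<le> a (l - 1)" using that by (intro le) auto
      then show ?thesis by (simp add: disjoint_iff)
    next
      case False
      then have "a l \<le> a (k - 1)" using that by (intro le) auto
      then show ?thesis by (simp add: disjoint_iff)
    qed
    show "local_to (?A k) (P k)" if "k \<in> ?K" for k
    proof (cases "k = 1")
      case True
      then show ?thesis by (simp add: local_to_def P_def)
    next
      case False
      then have "a (k - 1) + 2 \<le> a k" using that by (intro gap) auto
      then show ?thesis using False by (simp add: local_to_def P_def)
    qed
    show "card (arrangements (?A k) B (P k)) = N k" if "k \<in> ?K" "finite B" "card B = card (?A k)" for k B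
    proof (cases "k = 1")
      case True
      then have "P k = descending (a (k - 1)) (a k)" by (simp add: P_def fun_eq_iff)
      then show ?thesis using that True card_descending_arrangements[of B "a k" "a (k - 1)"] by (simp add: N_def)
    next
      case False
      then have g: "a (k - 1) + 2 \<le> a k" using that by (intro gap) auto
      have "P k = (\<lambda>w. w (a (k - 1)) < w (a (k - 1) + 1) \<and> descending (a (k - 1) + 1) (a k) w)"
        using False by (simp add: P_def fun_eq_iff)
      then show ?thesis
        using that False card_ascent_descending_arrangements[OF that(2) _ g] by (simp add: N_def)
    qed
    have "card (\<Union>k\<in>?K. ?A k) = (\<Sum>k\<in>?K. card (?A k))"
      using disj by (intro card_UN_disjoint) auto
    then show "card {1..n} = (\<Sum>k\<in>?K. card (?A k))" by (simp only: UN)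
  qed auto
  moreover have "(\<Prod>k\<in>?K. N k) = (\<Prod>k=2..p+1. a k - a (k - 1) - 1)"
  proof -
    have "?K = insert 1 {2..p+1}" by auto
    then have "(\<Prod>k\<in>?K. N k) = N 1 * (\<Prod>k=2..p+1. N k)" by simp
    also have "(\<Prod>k=2..p+1. N k) = (\<Prod>k=2..p+1. a k - a (k - 1) - 1)"
      by (intro prod.cong) (auto simp: N_def)
    finally show ?thesis by (simp add: N_def)
  qed
  ultimately show "card {w \<in> carrier (sym_group n).
        (\<forall>j\<in>I. w j < w (j + 1)) \<and> (\<forall>j\<in>nonshadow n I. w j > w (j + 1))}
      * (\<Prod>k=1..p+1. fact (a k - a (k - 1))) = fact n * (\<Prod>k=2..p+1. a k - a (k - 1) - 1)"
    unfolding arr by simp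
qed

lemma lacunar_pattern_multinomial:
  fixes a jj :: "nat \<Rightarrow> nat"
  assumes mono: "strict_mono_on {1..p} a" and I: "I = a ` {1..p}" "I \<subseteq> {1..n-1}" "lacunar I"
    and a0: "a 0 = 1" and ap: "a (p + 1) = n + 1" and jj: "\<forall>k\<in>{1..p+1}. jj k = a k - a (k - 1)"
  shows "real (card {w \<in> carrier (sym_group n).
        (\<forall>j\<in>I. w j < w (j + 1)) \<and> (\<forall>j\<in>nonshadow n I. w j > w (j + 1))})
      = fact n / (\<Prod>k=1..p+1. fact (jj k)) * (\<Prod>k=2..p+1. real (jj k) - 1)"
proof -
  let ?d = "card {w \<in> carrier (sym_group n).
        (\<forall>j\<in>I. w j < w (j + 1)) \<and> (\<forall>j\<in>nonshadow n I. w j > w (j + 1))}"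
  note cnt = card_lacunar_pattern[OF mono I a0 ap]
  have "(\<Prod>k=1..p+1. fact (a k - a (k - 1))) = (\<Prod>k=1..p+1. fact (jj k) :: nat)"
    using jj by (intro prod.cong) auto
  moreover have "(\<Prod>k=2..p+1. a k - a (k - 1) - 1) = (\<Prod>k=2..p+1. jj k - 1)"
    using jj by (intro prod.cong) auto
  ultimately have "?d * (\<Prod>k=1..p+1. fact (jj k)) = fact n * (\<Prod>k=2..p+1. jj k - 1)"
    using cnt(1) by simp
  then have "real (?d * (\<Prod>k=1..p+1. fact (jj k))) = real (fact n * (\<Prod>k=2..p+1. jj k - 1))"
    by (rule arg_cong)
  then have "real ?d * (\<Prod>k=1..p+1. fact (jj k)) = fact n * (\<Prod>k=2..p+1. real (jj k - 1))"
    by (simp only: of_nat_mult of_nat_prod of_nat_fact)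
  also have "(\<Prod>k=2..p+1. real (jj k - 1)) = (\<Prod>k=2..p+1. real (jj k) - 1)"
  proof (intro prod.cong)
    fix k assume k: "k \<in> {2..p+1}"
    then have "a (k - 1) + 2 \<le> a k" "jj k = a k - a (k - 1)" using cnt(2) jj by auto
    then show "real (jj k - 1) = real (jj k) - 1" by (simp add: of_nat_diff)
  qed simp
  finally show ?thesis by (simp add: field_simps)
qed

text \<open>
  The count is \<open>n!\<close> divided by the product of the \<open>m\<^sub>k! / (m\<^sub>k - 1)\<close> over the blocks \<open>k \<ge> 2\<close> and of
  \<open>m\<^sub>1!\<close>, where \<open>m\<^sub>k\<close> are the block lengths; these quotients are integers.
\<close>

lemma card_lacunar_pattern_dvd:
  assumes I: "I \<subseteq> {1..n-1}" "lacunar I"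
  shows "card {w \<in> carrier (sym_group n).
        (\<forall>j\<in>I. w j < w (j + 1)) \<and> (\<forall>j\<in>nonshadow n I. w j > w (j + 1))} dvd fact n"
proof -
  let ?d = "card {w \<in> carrier (sym_group n).
        (\<forall>j\<in>I. w j < w (j + 1)) \<and> (\<forall>j\<in>nonshadow n I. w j > w (j + 1))}"
  have "finite I" using I(1) finite_subset by blast
  then obtain h where h: "bij_betw h {..<card I} I" "strict_mono_on {..<card I} h"
    using ex_bij_betw_strict_mono_card by blast
  define p where "p = card I"
  define a where "a k = (if k = 0 then 1 else if k \<le> p then h (k - 1) else n + 1)" for k
  have mono: "strict_mono_on {1..p} a"
  proof (rule strict_mono_onI)
    fix k l assume "k \<in> {1..p}" "l \<in> {1..p}" "k < l"
    then show "a k < a l" using strict_mono_onD[OF h(2), of "k - 1" "l - 1"] by (auto simp: a_def p_def)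
  qed
  have img: "I = a ` {1..p}"
  proof -
    have "{1..p} = Suc ` {..<p}" by (simp add: image_Suc_lessThan)
    then have "a ` {1..p} = (\<lambda>k. a (Suc k)) ` {..<p}" by (simp add: image_image)
    also have "\<dots> = h ` {..<p}" by (intro image_cong) (auto simp: a_def)
    finally show ?thesis using h(1) by (simp add: p_def bij_betw_def)
  qed
  define m where "m k = a k - a (k - 1)" for k
  have cnt: "?d * (\<Prod>k=1..p+1. fact (m k)) = fact n * (\<Prod>k=2..p+1. m k - 1)"
    and gap: "\<forall>k\<in>{2..p+1}. a (k - 1) + 2 \<le> a k"
    using card_lacunar_pattern[OF mono img I] by (simp_all add: a_def m_def)
  have m2: "2 \<le> m k" if "k \<in> {2..p+1}" for k using gap that by (force simp: m_def)
  have fact2: "fact r = (r - 1) * (r * fact (r - 2))" if "2 \<le> r" for r :: nat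
  proof -
    obtain s where "r = Suc (Suc s)" using \<open>2 \<le> r\<close> by (metis add_2_eq_Suc le_Suc_ex)
    then show ?thesis by (simp add: algebra_simps)
  qed
  let ?C = "\<Prod>k=2..p+1. m k * fact (m k - 2)" and ?E = "\<Prod>k=2..p+1. m k - 1"
  have "{1..p+1} = insert 1 {2..p+1}" by auto
  then have "(\<Prod>k=1..p+1. fact (m k)) = fact (m 1) * (\<Prod>k=2..p+1. fact (m k) :: nat)" by simp
  also have "(\<Prod>k=2..p+1. fact (m k) :: nat) = (\<Prod>k=2..p+1. (m k - 1) * (m k * fact (m k - 2)))"
    using m2 fact2 by (intro prod.cong) auto
  also have "\<dots> = ?E * ?C" by (rule prod.distrib)
  finally have eq: "(?d * (fact (m 1) * ?C)) * ?E = fact n * ?E" using cnt by (simp only: mult_ac)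
  have "m k - 1 \<noteq> 0" if "k \<in> {2..p+1}" for k using m2[OF that] by simp
  then have "?E \<noteq> 0" by (simp only: prod_zero_iff finite_atLeastAtMost) blast
  then have "fact n = ?d * (fact (m 1) * ?C)" using eq by (simp only: mult_cancel2) simp
  then show ?thesis by (rule dvdI)
qed

theorem theorem13p1:
  fixes R :: "('a, 'm) ring_scheme"
    and n i \<delta> :: nat
    and Q :: "nat \<Rightarrow> nat set"
  assumes "cring R"
    and "lacunar_listing n Q"
    and "i \<in> {1..fib (n + 1)}"
    and "\<delta> = card {w \<in> carrier (sym_group n). Qind n Q w = i}"
  shows
    "free_of_rank R
       (quotient_module ((kS R n)\<lparr>carrier := F_filt R n Q i\<rparr>) (F_filt R n Q (i - 1))) \<delta>
     \<and> \<delta> = card {w \<in> carrier (sym_group n).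
               (\<forall>j\<in>Q i. w j < w (j + 1)) \<and> (\<forall>j\<in>nonshadow n (Q i). w j > w (j + 1))}
     \<and> (\<forall>(p::nat) (a::nat \<Rightarrow> nat) (jj::nat \<Rightarrow> nat).
          strict_mono_on {1..p} a \<and> Q i = a ` {1..p} \<and> a 0 = 1 \<and> a (p + 1) = n + 1 \<and>
          (\<forall>k\<in>{1..p+1}. jj k = a k - a (k - 1))
          \<longrightarrow> real \<delta> = fact n / (\<Prod>k=1..p+1. fact (jj k)) * (\<Prod>k=2..p+1. real (jj k) - 1))
     \<and> \<delta> dvd fact n"
proof -
  have Qi: "Q i \<subseteq> {1..n-1}" "lacunar (Q i)"
    using assms(2,3) bij_betwE by (fastforce simp: lacunar_listing_def)+
  have \<delta>: "\<delta> = card {w \<in> carrier (sym_group n).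
      (\<forall>j\<in>Q i. w j < w (j + 1)) \<and> (\<forall>j\<in>nonshadow n (Q i). w j > w (j + 1))}"
    using assms(4) Qind_fibre[OF assms(2,3)] by simp
  show ?thesis
  proof (intro conjI allI impI)
    show "free_of_rank R
       (quotient_module ((kS R n)\<lparr>carrier := F_filt R n Q i\<rparr>) (F_filt R n Q (i - 1))) \<delta>"
      unfolding assms(4) by (rule cring.free_of_rank_F_filt_quotient[OF assms(1-3)])
    show "\<delta> dvd fact n" unfolding \<delta> by (rule card_lacunar_pattern_dvd[OF Qi])
    show "real \<delta> = fact n / (\<Prod>k=1..p+1. fact (jj k)) * (\<Prod>k=2..p+1. real (jj k) - 1)"
      if "strict_mono_on {1..p} a \<and> Q i = a ` {1..p} \<and> a 0 = 1 \<and> a (p + 1) = n + 1 \<and>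
          (\<forall>k\<in>{1..p+1}. jj k = a k - a (k - 1))" for p :: nat and a jj :: "nat \<Rightarrow> nat"
      unfolding \<delta> by (rule lacunar_pattern_multinomial[where a = a]) (use that Qi in simp_all)
  qed (rule \<delta>)
qed

end
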